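(* Consider the problem $\min_{x\in\mathcal X}f(x)=\sum_{j=1}^mf_j(x)$, $f_j(x)=\mathbb E[F_j(x;\xi_j)]$, with $\mathcal X=\{x\in\mathbb R^d:Bx-b\le0,\ Cx-c\le0\}$, where $B\in\mathbb R^{d_1\times d}$, $b\in\mathbb R^{d_1}$, $C\in\mathbb R^{d_2\times d}$, $c\in\mathbb R^{d_2}$, and the distributed dual averaging algorithm with regularizer $\psi(x)=\frac12\|x\|^2$ described in the context. Let $x^*\in\mathcal X^*$ be the limit of $\{\bar x_k\}$, with $Bx^*=b$ and $Cx^*<c$. Suppose: 1. (Objective) For every $j$ and every $\xi_j$, $F_j(\cdot;\xi_j)$ is differentiable and convex on $\mathcal X$, and $|F_j(x;\xi_j)-F_j(y;\xi_j)|\le L_{0,j}(\xi_j)\|x-y\|$ for all $x,y\in\mathcal X$, with $L_{0,j}$ measurable and $\mathbb E[L_{0,j}^2(\xi_j)]<\infty$. There is $L>0$ with $\|\nabla f_j(x)-\nabla f_j(y)\|\le L\|x-y\|$ for all $x,y\in\mathcal X$ and all $j$. There are $c_0,\epsilon\in(0,\infty)$ with $\|\nabla f(x)-\nabla f(x^* )-\nabla^2f(x^* )(x-x^* )\|\le c_0\|x-x^*\|^2$ for all $x\in\mathcal X$ with $\|x-x^*\|\le\epsilon$. There is $\mu>0$ with $x^T\nabla^2f(x^* )x\ge\mu\|x\|^2$ for all $x$ in the critical tangent cone $\mathcal T_{\mathcal X}(x^* )=\{x:Bx=0\}$. 2. (Constraint qualification) $-\nabla f(x^* )\in\operatorname{ri}\mathcal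 N_{\mathcal X}(x^* )$, where $\mathcal N_{\mathcal X}(x^* )=\{B^T\lambda:\lambda\in\mathbb R^{d_1}_+\}$ is the normal cone and $\operatorname{ri}$ the relative interior. 3. (Weight matrices) $A_k$, $k\ge1$, are i.i.d. random doubly stochastic matrices with nonnegative entries; the spectral norm $\rho$ of $\mathbb E\big[A_k^T(I_m-\frac{\mathbf 1\mathbf 1^T}m)A_k\big]$ satisfies $\rho<1$; and $A_k$ is independent of $\mathcal F_k$ for every $k$. 4. (Step-size) $\alpha_k=a/k^\alpha$ with $\alpha\in(\frac23,1)$, $a>0$. 5. (Sampling) For all $i,j$: $\xi_{j,1},\xi_{j,2},\dots$ is an i.i.d. sample of $\xi_j$; for $i\ne j$, $\xi_{i,k}$ and $\xi_{j,k}$ are conditionally independent given $\mathcal F_k'=\sigma(\mathcal F_k\cup\sigma(A_k))$; and $\xi_{j,k}$ is conditionally independent of $A_k$ given $\mathcal F_k$. Let $P_B=I_d-B^T(BB^T)^\dagger B$ and $\Delta_k=P_B(\bar x_k-x^* )$. Then for any $\delta\in\big(0,1-\tfrac1{2\alpha}\big)$, $$\|\Delta_k\|=o(\alpha_k^\delta)\quad\text{almost surely.}$$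
   Context: Setting. $m$ agents; for each $1\le j\le m$, $\xi_j$ is a random vector on a probability space $(\Omega,\mathcal F,\mathbb P)$, $F_j(x;\xi_j)$ is real-valued, $f_j(x)=\mathbb E[F_j(x;\xi_j)]$, $f=\sum_jf_j$, and $\mathcal X^*$ is the set of minimizers of $f$ over $\mathcal X$. $\nabla F_j$ is the gradient in $x$. $\mathbf 1\in\mathbb R^m$ is the all-ones vector; $\|\cdot\|$ is the Euclidean norm of vectors and the spectral norm of matrices; vector inequalities are componentwise; $M^\dagger$ is the Moore–Penrose inverse. Algorithm (with $\psi(x)=\frac12\|x\|^2$). Let $\mathrm Q(z)=\arg\max_{x\in\mathcal X}\{\langle z,x\rangle-\frac12\|x\|^2\}$. Each agent $j$ starts from $z_{j,0}\in\mathbb R^d$ (possibly random). For $k=1,2,\dots$, $$x_{j,k}=\mathrm Q(z_{j,k-1}),\qquad z_{j,k}=\sum_{i=1}^m[A_k]_{ji}z_{i,k-1}-\alpha_k\nabla F_j(x_{j,k};\xi_{j,k}),$$ where $\xi_{j,k}$ is a sample of $\xi_j$ drawn at step $k$, $A_k\in\mathbb R^{m\times m}$ is the random weight matrix and $\alpha_k$ the step-size. Averages: $\bar z_k=\frac1m\sum_jz_{j,k}$, $\bar x_{k+1}=\mathrm Q(\bar z_k)$, $k\ge0$. Filtration. $\mathcal F_1=\sigma\{z_{j,0}:1\le j\le m\}$, $\mathcal F_k=\sigma\{z_{j,0},\xi_{j,t},A_t:1\le j\le m,\,1\le t\le k-1\}$. The point $x^*$. Under the listed hypotheses $\bar x_k$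 converges almost surely to a point of $\mathcal X^*$, denoted $x^*$; the second-order condition makes $x^*$ the unique minimizer of $f$ over $\mathcal X$. $Bx\le b$ collects the constraints active at $x^*$ and $Cx\le c$ the inactive ones. Conventions. The sample $\xi_{j,k}$ is drawn afresh, i.e. it is distributed as $\xi_j$ and independent of $\mathcal F_k$, so that $\mathbb E[\nabla F_j(x_{j,k};\xi_{j,k})-\nabla f_j(x_{j,k})\mid\mathcal F_k]=0$. The Lipschitz hypothesis is understood to include $\|\nabla F_j(x;\xi_j)\|\le L_{0,j}(\xi_j)$ and $\nabla f_j(x)=\mathbb E[\nabla F_j(x;\xi_j)]$ for $x\in\mathcal X$. *)

theory Defs
  imports "HOL-Probability.Probability" "HOL-Library.Landau_Symbols"
begin

(* Order on vectors: the library's "x \<le> y" on real ^ 'n is componentwise, but its "x < y" is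
   "x \<le> y \<and> \<not> y \<le> x"; strict componentwise inequalities are therefore written out. *)

definition feasible_set ::
  "real ^ 'd ^ 'p \<Rightarrow> real ^ 'p \<Rightarrow> real ^ 'd ^ 'q \<Rightarrow> real ^ 'q \<Rightarrow> (real ^ 'd) set" where
  "feasible_set B b C c = {x. B *v x - b \<le> 0 \<and> C *v x - c \<le> 0}"

definition critical_tangent_cone :: "real ^ 'd ^ 'p \<Rightarrow> (real ^ 'd) set" where
  "critical_tangent_cone B = {x. B *v x = 0}"

(* Normal cone of the polyhedron at a point where exactly the rows of B are active. *)
definition active_normal_cone :: "real ^ 'd ^ 'p \<Rightarrow> (real ^ 'd) set" where
  "active_normal_cone B = {transpose B *v l | l. 0 \<le> l}"

definition is_moore_penrose :: "real ^ 'n ^ 'k \<Rightarrow> real ^ 'k ^ 'n \<Rightarrow> bool" where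
  "is_moore_penrose M N \<longleftrightarrow>
     M ** N ** M = M \<and> N ** M ** N = N \<and>
     transpose (M ** N) = M ** N \<and> transpose (N ** M) = N ** M"

definition pinv :: "real ^ 'n ^ 'k \<Rightarrow> real ^ 'k ^ 'n" where
  "pinv M = (THE N. is_moore_penrose M N)"

definition proj_ker :: "real ^ 'd ^ 'p \<Rightarrow> real ^ 'd ^ 'd" where
  "proj_ker B = mat 1 - transpose B ** pinv (B ** transpose B) ** B"

(* Operator norm for the Euclidean norm; the norm of the type real ^ 'n ^ 'k itself is the
   Frobenius norm. *)
definition spectral_norm :: "real ^ 'n ^ 'k \<Rightarrow> real" where
  "spectral_norm M = onorm (\<lambda>v. M *v v)"

definition doubly_stochastic :: "real ^ 'm ^ 'm \<Rightarrow> bool" where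
  "doubly_stochastic W \<longleftrightarrow>
     (\<forall>i j. 0 \<le> W $ i $ j) \<and> (\<forall>i. (\<Sum>j\<in>UNIV. W $ i $ j) = 1) \<and> (\<forall>j. (\<Sum>i\<in>UNIV. W $ i $ j) = 1)"

(* The matrix 1 1^T / m. *)
definition averaging_matrix :: "real ^ 'm ^ 'm" where
  "averaging_matrix = (\<chi> i j. 1 / real CARD('m))"

(* G is a gradient of g on X. The derivative is taken within X, as in differentiable_on, so values
   of g outside X are irrelevant. A gradient on an open neighbourhood of X satisfies this. Where
   the derivative within X is not unique (X contained in a hyperplane), G may be any choice. *)
definition has_gradient_on ::
  "(real ^ 'd \<Rightarrow> real) \<Rightarrow> (real ^ 'd \<Rightarrow> real ^ 'd) \<Rightarrow> (real ^ 'd) set \<Rightarrow> bool" where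
  "has_gradient_on g G X \<longleftrightarrow> (\<forall>x\<in>X. (g has_derivative (\<lambda>h. G x \<bullet> h)) (at x within X))"

definition dual_map :: "(real ^ 'd) set \<Rightarrow> real ^ 'd \<Rightarrow> real ^ 'd" where
  "dual_map X z = (ARG_MAX (\<lambda>x. z \<bullet> x - (1/2) * (norm x)\<^sup>2) x. x \<in> X)"

definition history ::
  "'w measure \<Rightarrow> ('m::finite \<Rightarrow> 's measure) \<Rightarrow> ('m \<Rightarrow> 'w \<Rightarrow> real ^ 'd) \<Rightarrow>
   ('m \<Rightarrow> nat \<Rightarrow> 'w \<Rightarrow> 's) \<Rightarrow> (nat \<Rightarrow> 'w \<Rightarrow> real ^ 'm ^ 'm) \<Rightarrow> nat \<Rightarrow> 'w measure" where
  "history M S z0 \<xi> A k = sigma (space M)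
     ((\<Union>j. sets (vimage_algebra (space M) (z0 j) borel)) \<union>
      (\<Union>j. \<Union>t\<in>{1..k-1}. sets (vimage_algebra (space M) (\<xi> j t) (S j))) \<union>
      (\<Union>t\<in>{1..k-1}. sets (vimage_algebra (space M) (A t) borel)))"

definition adjoin :: "'w measure \<Rightarrow> 'w measure \<Rightarrow> 'b measure \<Rightarrow> ('w \<Rightarrow> 'b) \<Rightarrow> 'w measure" where
  "adjoin M G N Y = sigma (space M) (sets G \<union> sets (vimage_algebra (space M) Y N))"

definition indep_of_algebra ::
  "'w measure \<Rightarrow> 'a measure \<Rightarrow> ('w \<Rightarrow> 'a) \<Rightarrow> 'w measure \<Rightarrow> bool" where
  "indep_of_algebra M N Y G \<longleftrightarrow>
     prob_space.indep_set M (sets (vimage_algebra (space M) Y N)) (sets G)"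

definition cond_indep ::
  "'w measure \<Rightarrow> 'w measure \<Rightarrow> 'a measure \<Rightarrow> ('w \<Rightarrow> 'a) \<Rightarrow> 'b measure \<Rightarrow> ('w \<Rightarrow> 'b) \<Rightarrow> bool" where
  "cond_indep M G N Y N' Y' \<longleftrightarrow>
     (\<forall>E\<in>sets N. \<forall>E'\<in>sets N'. AE \<omega> in M.
        real_cond_exp M G (\<lambda>w. indicator E (Y w) * indicator E' (Y' w)) \<omega> =
        real_cond_exp M G (\<lambda>w. indicator E (Y w)) \<omega> *
        real_cond_exp M G (\<lambda>w. indicator E' (Y' w)) \<omega>)"

definition identically_distributed ::
  "'w measure \<Rightarrow> 'a measure \<Rightarrow> ('w \<Rightarrow> 'a) \<Rightarrow> ('w \<Rightarrow> 'a) \<Rightarrow> bool" where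
  "identically_distributed M N Y Y' \<longleftrightarrow> distr M N Y = distr M N Y'"

end

(* The dual map is the Euclidean projection onto X. After averaging over the agents the weights
   disappear, and zbar_k is zbar_0 minus the weighted sum of the mean stochastic gradients. Divided
   by the sum of the step-sizes it tends to a positive multiple of - grad f(xs): the noise is an
   L2-convergent martingale, the disagreement of the agents vanishes, and xbar_k converges to xs.
   As - grad f(xs) lies in the relative interior of the normal cone, the component of zbar_k - xs
   in the range of B^T eventually lies in that cone, so that xbar_{k+1} = xs + P_B (zbar_k - xs).
   From then on Delta_{k+1} = Delta_k - (alpha_k / m) (P_B H Delta_k + O(|Delta_k|^2) + consensus
   error) - alpha_k P_B (noise). Divided by alpha_k^delta this is a contraction perturbed by terms
   that vanish: delta < 1 - 1/(2 alpha) says exactly that the sum of alpha_k^(2 - 2 delta) is finite,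
   which controls both the rescaled martingale and the rescaled consensus error. *)

theory Submission
  imports Defs "HOL-Real_Asymp.Real_Asymp"
begin

section \<open>Perturbed contractions and weighted averages\<close>

text \<open>Beyond the weight matrices being doubly stochastic, chance enters only through three
  almost sure facts: convergence of the noise series for square-summable weights, a weighted decay
  of the disagreement, and the limit of xbar_k. Everything else concerns one trajectory. This
  separation matters because the index after which the active constraints stay identified depends on
  the future and need not be a stopping time; since the noise series converges along the entire run,
  its tails can be used after any such index. Only second moments of the gradients are at hand, so
  the martingale part rests on an L2 maximal inequality, and cross terms between mixing and
  gradients are estimated rather than cancelled. The quadratic remainder is absorbed merely because
  Delta_k tends to 0, so no preliminary rate has to be found.\<close>

lemma perturbed_contraction_tendsto_0:
  fixes v t s :: "nat \<Rightarrow> real"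
  assumes v: "\<And>k. 0 \<le> v k"
    and rec: "\<forall>\<^sub>F k in sequentially. v (Suc k) \<le> (1 - t k) * v k + t k * s k"
    and t: "\<forall>\<^sub>F k in sequentially. 0 \<le> t k \<and> t k \<le> 1"
    and div: "filterlim (\<lambda>n. \<Sum>k<n. t k) at_top sequentially"
    and s: "s \<longlonglongrightarrow> 0"
  shows "v \<longlonglongrightarrow> 0"
proof (rule LIMSEQ_I)
  fix e :: real assume e: "0 < e"
  have "\<forall>\<^sub>F k in sequentially. s k < e / 2"
    using s e by (intro order_tendstoD) auto
  with rec t have "\<forall>\<^sub>F k in sequentially. v (Suc k) \<le> (1 - t k) * v k + t k * s k
      \<and> 0 \<le> t k \<and> t k \<le> 1 \<and> s k < e / 2"
    by eventually_elim auto
  then obtain K where K: "\<And>k. k \<ge> K \<Longrightarrow> v (Suc k) \<le> (1 - t k) * v k + t k * s k"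
      "\<And>k. k \<ge> K \<Longrightarrow> 0 \<le> t k" "\<And>k. k \<ge> K \<Longrightarrow> t k \<le> 1" "\<And>k. k \<ge> K \<Longrightarrow> s k < e / 2"
    unfolding eventually_sequentially by blast
  define T where "T n = (\<Sum>k<n. t k)" for n
  \<comment> \<open>Since 1 - t <= exp (- t), the initial value decays like
    \<open>exp (- T n)\<close>; the factor \<open>exp (T K)\<close> normalises this majorant to
    \<open>v K\<close> at \<open>n = K\<close>.\<close>
  define D where "D = v K * exp (T K)"
  have bound: "v n \<le> e / 2 + D * exp (- T n)" if "n \<ge> K" for n
    using that
  proof (induction n rule: dec_induct)
    case base
    have "D * exp (- T K) = v K" by (simp add: D_def exp_minus)
    then show ?case using e by simp
  next
    case (step n)
    have D: "0 \<le> D * exp (- T n)" using v[of K] by (simp add: D_def)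
    have "v (Suc n) \<le> (1 - t n) * v n + t n * s n" using K step by auto
    also have "\<dots> \<le> (1 - t n) * (e / 2 + D * exp (- T n)) + t n * (e / 2)"
      using K[of n] step by (intro add_mono mult_left_mono) auto
    also have "\<dots> = e / 2 + (1 - t n) * (D * exp (- T n))" by (simp add: field_simps)
    also have "\<dots> \<le> e / 2 + exp (- t n) * (D * exp (- T n))"
      using D exp_ge_add_one_self[of "- t n"] by (intro add_left_mono mult_right_mono) auto
    also have "\<dots> = e / 2 + D * exp (- T (Suc n))"
      by (simp add: T_def mult_exp_exp[symmetric] minus_add_distrib)
         (simp add: exp_diff exp_minus field_simps)
    finally show ?case .
  qed
  have "filterlim T at_top sequentially" using div unfolding T_def .
  then have "(\<lambda>n. D * exp (- T n)) \<longlonglongrightarrow> D * 0"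
    by (intro tendsto_intros filterlim_compose[OF exp_at_bot])
       (simp add: filterlim_uminus_at_bot)
  then have "\<forall>\<^sub>F n in sequentially. D * exp (- T n) < e / 2"
    using e by (intro order_tendstoD) auto
  then obtain N where N: "\<And>n. n \<ge> N \<Longrightarrow> D * exp (- T n) < e / 2"
    unfolding eventually_sequentially by blast
  show "\<exists>no. \<forall>n\<ge>no. norm (v n - 0) < e"
  proof (intro exI allI impI)
    fix n assume "n \<ge> max K N"
    then have "v n \<le> e / 2 + D * exp (- T n)" "D * exp (- T n) < e / 2" using bound N by auto
    then show "norm (v n - 0) < e" using v[of n] by auto
  qed
qed

text \<open>Toeplitz averaging: before \<open>K\<close> the terms contribute at most the fixed
  amount \<open>D\<close>, which the diverging total weight outgrows, and beyond \<open>K\<close>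
  they are uniformly small. It later shows that gradient deviations and consensus errors do not
  affect the limiting direction of the averaged dual variable.\<close>

lemma weighted_average_tendsto_0:
  fixes r :: "nat \<Rightarrow> 'a::real_normed_vector" and w :: "nat \<Rightarrow> real"
  assumes w: "\<And>k. 0 \<le> w k" and div: "filterlim (\<lambda>n. \<Sum>k<n. w k) at_top sequentially"
    and r: "r \<longlonglongrightarrow> 0"
  shows "(\<lambda>n. (\<Sum>k<n. w k *\<^sub>R r k) /\<^sub>R (\<Sum>k<n. w k)) \<longlonglongrightarrow> 0"
proof (rule tendsto_norm_zero_cancel, rule LIMSEQ_I)
  fix e :: real assume e: "0 < e"
  define T where "T n = (\<Sum>k<n. w k)" for n
  obtain K where K: "\<And>k. k \<ge> K \<Longrightarrow> norm (r k) < e / 2"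
    using LIMSEQ_D[OF r, of "e / 2"] e by auto
  define D where "D = (\<Sum>k<K. w k * norm (r k))"
  have D: "0 \<le> D" unfolding D_def using w by (intro sum_nonneg) auto
  have bound: "(\<Sum>k<n. w k * norm (r k)) \<le> D + e / 2 * T n" for n
  proof -
    have "(\<Sum>k<n. w k * norm (r k)) \<le> (\<Sum>k<n. (if k < K then w k * norm (r k) else 0) + e / 2 * w k)"
    proof (intro sum_mono)
      fix k
      show "w k * norm (r k) \<le> (if k < K then w k * norm (r k) else 0) + e / 2 * w k"
        using w[of k] e K[of k] mult_left_mono[of "norm (r k)" "e/2" "w k"]
        by (auto simp: mult.commute)
    qed
    also have "\<dots> = (\<Sum>k<n. if k < K then w k * norm (r k) else 0) + e / 2 * T n"
      by (simp add: sum.distrib sum_distrib_left T_def)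
    also have "(\<Sum>k<n. if k < K then w k * norm (r k) else 0) = (\<Sum>k\<in>{..<n} \<inter> {..<K}. w k * norm (r k))"
      by (simp add: sum.If_cases lessThan_def)
    also have "\<dots> \<le> D" unfolding D_def using w by (intro sum_mono2) auto
    finally show ?thesis by simp
  qed
  have "filterlim T at_top sequentially" using div unfolding T_def .
  then have "\<forall>\<^sub>F n in sequentially. T n > 2 * D / e + 1"
    by (simp add: filterlim_at_top_dense)
  then obtain N where N: "\<And>n. n \<ge> N \<Longrightarrow> T n > 2 * D / e + 1"
    unfolding eventually_sequentially by blast
  show "\<exists>no. \<forall>n\<ge>no. norm (norm ((\<Sum>k<n. w k *\<^sub>R r k) /\<^sub>R (\<Sum>k<n. w k)) - 0) < e"
  proof (intro exI allI impI)
    fix n assume "n \<ge> N"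
    with N have n: "T n > 2 * D / e + 1" by auto
    then have pos: "T n > 0" using D e by (smt (verit) divide_nonneg_pos)
    have "norm (\<Sum>k<n. w k *\<^sub>R r k) \<le> (\<Sum>k<n. w k * norm (r k))"
      using w by (intro order_trans[OF norm_sum] sum_mono) auto
    also have "\<dots> \<le> D + e / 2 * T n" by (rule bound)
    also have "\<dots> < e * T n" using n e by (simp add: field_simps)
    finally show "norm (norm ((\<Sum>k<n. w k *\<^sub>R r k) /\<^sub>R (\<Sum>k<n. w k)) - 0) < e"
      using pos by (simp add: T_def[symmetric] field_simps)
  qed
qed

section \<open>The Moore-Penrose inverse and the projection onto a kernel\<close>

text \<open>An orthonormal basis \<open>E\<close> of \<open>S\<close> gives the projection as a sum
  of rank-one maps, from which symmetry can be read off. The matrix form is needed because the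
  Penrose equations speak of transposes.\<close>

lemma orthogonal_projection_matrix_exists:
  fixes S :: "(real ^ 'n) set"
  assumes "subspace S"
  obtains P :: "real ^ 'n ^ 'n" where "transpose P = P"
    "\<And>y. P *v y \<in> S" "\<And>y. y \<in> S \<Longrightarrow> P *v y = y"
proof -
  obtain E where E: "E \<subseteq> S" "pairwise orthogonal E" "\<And>x. x \<in> E \<Longrightarrow> norm x = 1"
      "independent E" "span E = S"
    using orthonormal_basis_subspace[OF assms] by metis
  have fin: "finite E" using E(4) by (rule independent_imp_finite)
  define P :: "real ^ 'n ^ 'n" where "P = matrix (\<lambda>y. \<Sum>e\<in>E. (y \<bullet> e) *\<^sub>R e)"
  have "linear (\<lambda>y. \<Sum>e\<in>E. (y \<bullet> e) *\<^sub>R e)"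
    by (intro linear_compose_sum ballI linearI) (auto simp: inner_left_distrib algebra_simps)
  then have P: "P *v y = (\<Sum>e\<in>E. (y \<bullet> e) *\<^sub>R e)" for y
    unfolding P_def by (simp add: matrix_works)
  have "transpose P *v y = P *v y" for y
  proof (rule vector_eq_ldot[THEN iffD1], intro allI)
    fix x
    have "x \<bullet> (transpose P *v y) = (P *v x) \<bullet> y"
      by (simp add: dot_lmul_matrix[symmetric] vector_transpose_matrix inner_commute)
    also have "\<dots> = x \<bullet> (P *v y)"
      by (simp add: P inner_sum_left inner_sum_right inner_commute mult.commute)
    finally show "x \<bullet> (transpose P *v y) = x \<bullet> (P *v y)" .
  qed
  then have "transpose P = P" by (simp add: matrix_eq)
  moreover have "P *v y \<in> S" for y
    unfolding P E(5)[symmetric] by (intro span_sum span_scale span_base)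
  moreover have "P *v y = y" if "y \<in> S" for y
  proof -
    have "orthogonal (y - P *v y) x" if "x \<in> span E" for x
      using that
    proof (rule orthogonal_to_span)
      fix e assume e: "e \<in> E"
      have "(P *v y) \<bullet> e = (\<Sum>e'\<in>E. (y \<bullet> e') * (e' \<bullet> e))" by (simp add: P inner_sum_left)
      also have "\<dots> = (\<Sum>e'\<in>E. if e' = e then y \<bullet> e else 0)"
        using E(2,3) e by (intro sum.cong) (auto simp: pairwise_def orthogonal_def norm_eq_1)
      also have "\<dots> = y \<bullet> e" using fin e by simp
      finally show "orthogonal (y - P *v y) e" by (simp add: orthogonal_def inner_diff_left)
    qed
    moreover have "y - P *v y \<in> span E" using that \<open>\<And>y. P *v y \<in> S\<close> E(5) assms
      by (simp add: subspace_diff)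
    ultimately show ?thesis by (metis orthogonal_self right_minus_eq)
  qed
  ultimately show ?thesis using that by blast
qed

text \<open>\<open>G\<close> maps the orthogonal complement \<open>S\<close> of its kernel
  bijectively onto its range. Inverting this bijection after projecting orthogonally onto the range
  gives \<open>N\<close>; then \<open>N ** G\<close> and \<open>G ** N\<close> are the orthogonal
  projections \<open>Q\<close> and \<open>P\<close>, which are symmetric. Redundant active
  constraints make \<open>B ** transpose B\<close> singular, so the argument has to cover every
  rank.\<close>

lemma is_moore_penrose_exists:
  fixes G :: "real ^ 'n ^ 'k"
  obtains N where "is_moore_penrose G N"
proof -
  define S where "S = {x. \<forall>k. G *v k = 0 \<longrightarrow> x \<bullet> k = 0}"
  have S: "subspace S" by (auto simp: S_def subspace_def inner_left_distrib)
  have R: "subspace (range ((*v) G))" by (intro linear_subspace_image) (auto)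
  obtain Q where Q: "transpose Q = Q" "\<And>y. Q *v y \<in> S" "\<And>y. y \<in> S \<Longrightarrow> Q *v y = y"
    using orthogonal_projection_matrix_exists[OF S] by blast
  obtain P where P: "transpose P = P" "\<And>y. P *v y \<in> range ((*v) G)"
      "\<And>y. y \<in> range ((*v) G) \<Longrightarrow> P *v y = y"
    using orthogonal_projection_matrix_exists[OF R] by blast
  have GQ: "G *v (Q *v x) = G *v x" for x
  proof -
    obtain y z where yz: "y \<in> span {k. G *v k = 0}" "\<And>w. w \<in> span {k. G *v k = 0} \<Longrightarrow> orthogonal z w"
        "x = y + z"
      using orthogonal_subspace_decomp_exists by metis
    have "subspace {k. G *v k = 0}"
      by (auto simp: subspace_def matrix_vector_right_distrib matrix_vector_mult_scaleR)
    then have y: "G *v y = 0" using yz(1) by (simp add: span_eq_iff[THEN iffD2])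
    have z: "z \<in> S" using yz(2) by (auto simp: S_def orthogonal_def span_base)
    have "Q *v y = 0"
    proof -
      have "(Q *v y) \<bullet> (Q *v y) = y \<bullet> (Q *v (Q *v y))"
        by (metis Q(1) dot_lmul_matrix vector_transpose_matrix)
      also have "\<dots> = (Q *v y) \<bullet> y" using Q(2,3) by (simp add: inner_commute)
      also have "\<dots> = 0" using Q(2)[of y] y by (auto simp: S_def)
      finally show ?thesis by simp
    qed
    then show ?thesis using y z Q(3) yz(3) by (simp add: matrix_vector_right_distrib)
  qed
  have inj: "inj_on ((*v) G) S"
  proof (rule inj_onI)
    fix x y assume xy: "x \<in> S" "y \<in> S" "G *v x = G *v y"
    then have "G *v (x - y) = 0" by (simp add: matrix_vector_mult_diff_distrib)
    moreover have "x - y \<in> S" using S xy by (simp add: subspace_diff)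
    ultimately have "(x - y) \<bullet> (x - y) = 0" unfolding S_def by blast
    then show "x = y" by simp
  qed
  obtain g where g: "g ` UNIV \<subseteq> S" "linear g" "\<And>v. v \<in> S \<Longrightarrow> g (G *v v) = v"
    using linear_exists_left_inverse_on[OF matrix_vector_mul_linear S inj] by auto
  define N where "N = matrix g ** P"
  have N: "N *v y = g (P *v y)" for y
    unfolding N_def by (simp add: matrix_vector_mul_assoc[symmetric] matrix_works g(2))
  have NG: "N *v (G *v x) = Q *v x" for x
  proof -
    have "N *v (G *v x) = g (G *v (Q *v x))" by (simp add: N P(3) GQ)
    also have "\<dots> = Q *v x" using g(3) Q(2) by blast
    finally show ?thesis .
  qed
  have GN: "G *v (N *v y) = P *v y" for y
  proof -
    obtain x where x: "P *v y = G *v x" using P(2)[of y] by auto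
    have "N *v y = g (G *v (Q *v x))" by (simp add: N x GQ)
    also have "\<dots> = Q *v x" using g(3) Q(2) by blast
    finally show ?thesis by (simp add: GQ x)
  qed
  have "N ** G = Q" "G ** N = P"
    by (simp_all add: matrix_eq matrix_vector_mul_assoc[symmetric] NG GN)
  moreover have "G ** N ** G = G" "N ** G ** N = N"
    using g(1) Q(3) by (simp_all add: matrix_eq matrix_vector_mul_assoc[symmetric] NG GQ)
       (metis N rangeI subsetD)
  ultimately have "is_moore_penrose G N" by (simp add: is_moore_penrose_def P(1) Q(1))
  then show ?thesis by (rule that)
qed

text \<open>\<open>G ** N\<close> and \<open>G ** N'\<close> are symmetric and absorb each other, so
  transposing their product shows them equal; likewise on the other side. As \<open>pinv\<close> is
  a definite description, it takes existence and uniqueness together to give it a value.\<close>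

lemma is_moore_penrose_unique:
  assumes N: "is_moore_penrose G N" and N': "is_moore_penrose G N'"
  shows "N = N'"
proof -
  have "G ** N = (G ** N') ** (G ** N)"
    using N' by (simp add: is_moore_penrose_def matrix_mul_assoc)
  also have "\<dots> = transpose ((G ** N) ** (G ** N'))"
    using N N' by (simp add: is_moore_penrose_def matrix_transpose_mul)
  also have "\<dots> = G ** N'"
    using N N' by (simp add: is_moore_penrose_def matrix_mul_assoc)
  finally have GN: "G ** N = G ** N'" .
  have "N ** G = (N ** G) ** (N' ** G)"
    using N' by (metis is_moore_penrose_def matrix_mul_assoc)
  also have "\<dots> = transpose ((N' ** G) ** (N ** G))"
    using N N' by (simp add: is_moore_penrose_def matrix_transpose_mul)
  also have "\<dots> = N' ** G"
    using N N' by (metis is_moore_penrose_def matrix_mul_assoc)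
  finally have NG: "N ** G = N' ** G" .
  have "N = N ** G ** N" using N by (simp add: is_moore_penrose_def)
  also have "\<dots> = N' ** G ** N'" using GN NG by (metis matrix_mul_assoc)
  also have "\<dots> = N'" using N' by (simp add: is_moore_penrose_def)
  finally show ?thesis .
qed

lemma is_moore_penrose_pinv: "is_moore_penrose G (pinv G)"
proof -
  obtain N where "is_moore_penrose G N" by (rule is_moore_penrose_exists)
  then show ?thesis unfolding pinv_def
    by (rule theI) (rule is_moore_penrose_unique[OF _ \<open>is_moore_penrose G N\<close>])
qed

lemma inner_transpose_mult: "(transpose B *v l) \<bullet> v = l \<bullet> (B *v v)"
  for B :: "real ^ 'n ^ 'k"
  by (simp add: dot_lmul_matrix)

lemma proj_ker_mult: "proj_ker B *v v = v - transpose B *v (pinv (B ** transpose B) *v (B *v v))"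
  by (simp add: proj_ker_def matrix_vector_mult_diff_rdistrib matrix_vector_mul_assoc[symmetric])

lemma proj_ker_kernel: "B *v v = 0 \<Longrightarrow> proj_ker B *v v = v"
  by (simp add: proj_ker_mult)

text \<open>For \<open>w = l - pinv G *v (G *v l)\<close> one has \<open>G *v w = 0\<close>, and
  |B^T w|^2 = w . G w, so B^T w = 0 even when \<open>G\<close> is singular. Hence the term that
  \<open>proj_ker\<close> subtracts restores all of B^T l.\<close>

lemma proj_ker_range_transpose: "proj_ker B *v (transpose B *v l) = 0"
proof -
  define G where "G = B ** transpose B"
  define w where "w = l - pinv G *v (G *v l)"
  have "G ** pinv G ** G = G" using is_moore_penrose_pinv by (auto simp: is_moore_penrose_def)
  then have "G *v (pinv G *v (G *v l)) = G *v l"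
    by (simp only: matrix_vector_mul_assoc matrix_mul_assoc)
  then have "G *v w = 0" by (simp add: w_def matrix_vector_mult_diff_distrib)
  then have "(transpose B *v w) \<bullet> (transpose B *v w) = 0"
    by (simp only: inner_transpose_mult G_def matrix_vector_mul_assoc inner_zero_right)
  then have "transpose B *v w = 0" by simp
  then show ?thesis
    by (simp add: proj_ker_mult w_def G_def matrix_vector_mult_diff_distrib matrix_vector_mul_assoc[symmetric])
qed

lemma kernel_range_transpose_decomp:
  fixes B :: "real ^ 'd ^ 'p"
  obtains k l where "B *v k = 0" "v = k + transpose B *v l"
proof -
  let ?R = "range ((*v) (transpose B))"
  have R: "subspace ?R" by (intro linear_subspace_image) auto
  obtain y z where yz: "y \<in> span ?R" "\<And>w. w \<in> span ?R \<Longrightarrow> orthogonal z w" "v = y + z"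
    using orthogonal_subspace_decomp_exists by metis
  obtain l where l: "y = transpose B *v l" using yz(1) R by (auto simp: span_eq_iff[THEN iffD2])
  have "(B *v z) \<bullet> (B *v z) = z \<bullet> (transpose B *v (B *v z))"
    by (metis inner_transpose_mult inner_commute)
  also have "\<dots> = 0" using yz(2)[OF span_base[OF rangeI]] by (simp only: orthogonal_def)
  finally show ?thesis using that[of z l] l yz(3) by (simp add: add.commute)
qed

lemma mult_proj_ker: "B *v (proj_ker B *v v) = 0"
  by (rule kernel_range_transpose_decomp[of B v])
     (simp add: matrix_vector_right_distrib proj_ker_range_transpose proj_ker_kernel
       del: transpose_matrix_vector)

lemma proj_ker_complement: obtains l where "v - proj_ker B *v v = transpose B *v l"
  by (simp add: proj_ker_mult)

lemma norm_proj_ker_le: "norm (proj_ker B *v v) \<le> norm v"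
proof -
  obtain l where l: "v - proj_ker B *v v = transpose B *v l" by (rule proj_ker_complement)
  then have "(v - proj_ker B *v v) \<bullet> (proj_ker B *v v) = 0"
    by (simp add: inner_transpose_mult mult_proj_ker del: transpose_matrix_vector)
  then have "(norm (proj_ker B *v v))\<^sup>2 = v \<bullet> (proj_ker B *v v)"
    by (simp add: inner_diff_left power2_norm_eq_inner)
  also have "\<dots> \<le> norm v * norm (proj_ker B *v v)" by (rule norm_cauchy_schwarz)
  finally have "norm (proj_ker B *v v) * norm (proj_ker B *v v) \<le> norm v * norm (proj_ker B *v v)"
    by (simp add: power2_eq_square)
  then show ?thesis
    by (cases "norm (proj_ker B *v v) = 0") (auto dest: mult_right_le_imp_le)
qed

section \<open>Projection onto a polyhedron\<close>

lemma feasible_set_iff: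
  "x \<in> feasible_set B b C c \<longleftrightarrow> (\<forall>i. (B *v x) $ i \<le> b $ i) \<and> (\<forall>i. (C *v x) $ i \<le> c $ i)"
  by (auto simp: feasible_set_def less_eq_vec_def)

lemma continuous_on_matrix_component: "continuous_on UNIV (\<lambda>x. (B *v x) $ i)"
  for B :: "real ^ 'd ^ 'p"
  by (intro continuous_on_component linear_continuous_on linear_linear[THEN iffD2]) auto

lemma closed_feasible_set: "closed (feasible_set B b C c)"
proof -
  have "feasible_set B b C c = (\<Inter>i. {x. (B *v x) $ i \<le> b $ i}) \<inter> (\<Inter>i. {x. (C *v x) $ i \<le> c $ i})"
    by (auto simp: feasible_set_iff)
  also have "closed \<dots>"
    by (intro closed_Int closed_INT ballI closed_Collect_le continuous_on_matrix_component
        continuous_on_const)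
  finally show ?thesis .
qed

lemma convex_feasible_set: "convex (feasible_set B b C c)"
  unfolding convex_def
  by (auto simp: feasible_set_iff matrix_vector_right_distrib matrix_vector_mult_scaleR
      intro!: convex_bound_le)

text \<open>Completing the square turns the objective into a constant minus half the squared
  distance from \<open>z\<close>. Uniqueness of the closest point matters because
  \<open>ARG_MAX\<close> only chooses some maximiser.\<close>

lemma dual_map_eq_closest_point:
  assumes "closed X" "convex X" "X \<noteq> {}"
  shows "dual_map X z = closest_point X z"
proof -
  let ?p = "closest_point X z"
  have obj: "z \<bullet> x - (1/2) * (norm x)\<^sup>2 = (norm z)\<^sup>2 / 2 - (dist z x)\<^sup>2 / 2" for x
    by (simp add: dist_norm power2_norm_eq_inner inner_diff_left inner_diff_right inner_commute field_simps)
  have p: "?p \<in> X" using assms by (intro closest_point_in_set)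
  have le: "dist z ?p \<le> dist z y" if "y \<in> X" for y
    using that assms by (intro closest_point_le)
  have max: "is_arg_max (\<lambda>x. z \<bullet> x - (1/2) * (norm x)\<^sup>2) (\<lambda>x. x \<in> X) ?p"
    unfolding is_arg_max_def obj using p le by (auto simp: not_less intro: power_mono)
  have uniq: "y = ?p" if "is_arg_max (\<lambda>x. z \<bullet> x - (1/2) * (norm x)\<^sup>2) (\<lambda>x. x \<in> X) y" for y
  proof (rule closest_point_unique)
    show "convex X" "closed X" using assms by auto
    show "y \<in> X" using that by (simp add: is_arg_max_def)
    have "dist z y \<le> dist z ?p"
      using that p unfolding is_arg_max_def obj by (simp add: not_less power_mono_iff)
    then show "\<forall>w\<in>X. dist z y \<le> dist z w" using le by (blast intro: order_trans)
  qed
  show ?thesis unfolding dual_map_def arg_max_def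
    using max uniq by (rule someI2)
qed

section \<open>Fresh samples and martingale differences\<close>

text \<open>For \<open>U\<close> measurable with respect to \<open>G\<close>, independence gives the
  product formula on rectangles, hence the product law. In this form a fresh sample is integrated
  out by Fubini with the past held fixed, in place of conditional expectations.\<close>

lemma (in prob_space) indep_of_algebra_distr:
  assumes ind: "indep_of_algebra M N Y G" and Y[measurable]: "Y \<in> measurable M N"
    and G: "subalgebra M G" and U: "U \<in> measurable G K"
  shows "distr M (K \<Otimes>\<^sub>M N) (\<lambda>w. (U w, Y w)) = distr M K U \<Otimes>\<^sub>M distr M N Y"
proof -
  have U'[measurable]: "U \<in> measurable M K" using G U by (rule measurable_from_subalg)
  have sp: "space G = space M" using G by (simp add: subalgebra_def)
  have ind': "indep_set (sets (vimage_algebra (space M) Y N)) (sets G)"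
    using ind by (simp add: indep_of_algebra_def)
  interpret D1: prob_space "distr M K U" by (rule prob_space_distr) measurable
  interpret D2: prob_space "distr M N Y" by (rule prob_space_distr) measurable
  show ?thesis
  proof (rule pair_measure_eqI[symmetric])
    fix A B assume A: "A \<in> sets (distr M K U)" and B: "B \<in> sets (distr M N Y)"
    then have [measurable]: "A \<in> sets K" "B \<in> sets N" by auto
    have "U -` A \<inter> space M \<in> sets G" using measurable_sets[OF U, of A] sp by simp
    moreover have "Y -` B \<inter> space M \<in> sets (vimage_algebra (space M) Y N)"
      by (intro in_vimage_algebra) simp
    ultimately have "prob ((Y -` B \<inter> space M) \<inter> (U -` A \<inter> space M)) =
        prob (Y -` B \<inter> space M) * prob (U -` A \<inter> space M)"
      using ind' by (simp add: indep_sets2_eq)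
    moreover have "(\<lambda>w. (U w, Y w)) -` (A \<times> B) \<inter> space M = (Y -` B \<inter> space M) \<inter> (U -` A \<inter> space M)"
      by auto
    ultimately show "emeasure (distr M K U) A * emeasure (distr M N Y) B =
        emeasure (distr M (K \<Otimes>\<^sub>M N) (\<lambda>w. (U w, Y w))) (A \<times> B)"
      by (simp add: emeasure_distr emeasure_eq_measure ennreal_mult'' mult.commute)
  qed (simp_all add: D1.sigma_finite_measure_axioms D2.sigma_finite_measure_axioms)
qed

text \<open>The inner integral over the fresh \<open>Y\<close> vanishes for every frozen past. This
  is the martingale difference property, expressed by testing against weights \<open>W\<close> that
  depend on the past.\<close>

lemma (in prob_space) expectation_mult_fresh_eq_0:
  fixes h :: "'b \<Rightarrow> 'c \<Rightarrow> real"
  assumes ind: "indep_of_algebra M N Y G" and Y[measurable]: "Y \<in> measurable M N"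
    and G: "subalgebra M G" and U: "U \<in> measurable G K" and W: "W \<in> borel_measurable G"
    and h[measurable]: "(\<lambda>(u, y). h u y) \<in> borel_measurable (K \<Otimes>\<^sub>M N)"
    and mean: "\<And>u. u \<in> space K \<Longrightarrow> (LINT y|distr M N Y. h u y) = 0"
    and int: "integrable M (\<lambda>w. W w * h (U w) (Y w))"
  shows "expectation (\<lambda>w. W w * h (U w) (Y w)) = 0"
proof -
  note [measurable] = measurable_from_subalg[OF G U] measurable_from_subalg[OF G W]
  let ?B = "borel \<Otimes>\<^sub>M K :: (real \<times> 'b) measure"
  have WU: "(\<lambda>w. (W w, U w)) \<in> measurable G ?B" using W U by simp
  interpret D1: prob_space "distr M ?B (\<lambda>w. (W w, U w))" by (rule prob_space_distr) measurable
  interpret D2: prob_space "distr M N Y" by (rule prob_space_distr) measurable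
  interpret D: pair_sigma_finite "distr M ?B (\<lambda>w. (W w, U w))" "distr M N Y" ..
  define \<phi> where "\<phi> = (\<lambda>p :: (real \<times> 'b) \<times> 'c. fst (fst p) * h (snd (fst p)) (snd p))"
  have \<phi>[measurable]: "\<phi> \<in> borel_measurable (?B \<Otimes>\<^sub>M N)"
  proof -
    have "(\<lambda>p. (\<lambda>(u, y). h u y) (snd (fst p), snd p)) \<in> borel_measurable (?B \<Otimes>\<^sub>M N)"
      by measurable
    then show ?thesis unfolding \<phi>_def by simp
  qed
  note eq = indep_of_algebra_distr[OF ind Y G WU]
  have "integrable (distr M (?B \<Otimes>\<^sub>M N) (\<lambda>w. ((W w, U w), Y w))) \<phi>"
    using int by (subst integrable_distr_eq) (auto simp: \<phi>_def)
  then have int\<phi>: "integrable (distr M ?B (\<lambda>w. (W w, U w)) \<Otimes>\<^sub>M distr M N Y) \<phi>"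
    by (simp only: eq)
  have "expectation (\<lambda>w. W w * h (U w) (Y w)) =
      integral\<^sup>L (distr M (?B \<Otimes>\<^sub>M N) (\<lambda>w. ((W w, U w), Y w))) \<phi>"
    by (subst integral_distr) (auto simp: \<phi>_def)
  also have "\<dots> = (LINT p|distr M ?B (\<lambda>w. (W w, U w)). LINT y|distr M N Y. \<phi> (p, y))"
    unfolding eq by (rule D.integral_fst'[OF int\<phi>, symmetric])
  also have "\<dots> = (LINT p|distr M ?B (\<lambda>w. (W w, U w)). 0)"
    by (intro Bochner_Integration.integral_cong) (auto simp: \<phi>_def mean space_pair_measure)
  finally show ?thesis by simp
qed

text \<open>Freezing the past turns a bound for each fixed \<open>u\<close> into a bound on the
  average. Working in \<open>ennreal\<close> avoids asking beforehand whether the second moments of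
  the disagreement are finite.\<close>

lemma (in prob_space) nn_integral_fresh_le:
  fixes \<phi> :: "'b \<Rightarrow> 'c \<Rightarrow> ennreal"
  assumes ind: "indep_of_algebra M N Y G" and Y[measurable]: "Y \<in> measurable M N"
    and G: "subalgebra M G" and U: "U \<in> measurable G K"
    and h[measurable]: "(\<lambda>(u, y). \<phi> u y) \<in> borel_measurable (K \<Otimes>\<^sub>M N)"
    and \<psi>[measurable]: "\<psi> \<in> borel_measurable K"
    and le: "\<And>u. u \<in> space K \<Longrightarrow> (\<integral>\<^sup>+ w. \<phi> u (Y w) \<partial>M) \<le> \<psi> u"
  shows "(\<integral>\<^sup>+ w. \<phi> (U w) (Y w) \<partial>M) \<le> (\<integral>\<^sup>+ w. \<psi> (U w) \<partial>M)"
proof -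
  note [measurable] = measurable_from_subalg[OF G U]
  interpret D2: prob_space "distr M N Y" by (rule prob_space_distr) measurable
  have "(\<integral>\<^sup>+ w. \<phi> (U w) (Y w) \<partial>M) =
      (\<integral>\<^sup>+ p. (\<lambda>(u, y). \<phi> u y) p \<partial>distr M (K \<Otimes>\<^sub>M N) (\<lambda>w. (U w, Y w)))"
    by (subst nn_integral_distr) auto
  also have "\<dots> = (\<integral>\<^sup>+ u. \<integral>\<^sup>+ y. \<phi> u y \<partial>distr M N Y \<partial>distr M K U)"
    unfolding indep_of_algebra_distr[OF ind Y G U]
    by (subst D2.nn_integral_fst[symmetric]) auto
  also have "\<dots> \<le> (\<integral>\<^sup>+ u. \<psi> u \<partial>distr M K U)"
  proof (rule nn_integral_mono)
    fix u assume "u \<in> space (distr M K U)"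
    then have u: "u \<in> space K" by simp
    have [measurable]: "\<phi> u \<in> borel_measurable N" using measurable_Pair2[OF h u] by simp
    show "(\<integral>\<^sup>+ y. \<phi> u y \<partial>distr M N Y) \<le> \<psi> u"
      using le[OF u] by (subst nn_integral_distr) auto
  qed
  also have "\<dots> = (\<integral>\<^sup>+ w. \<psi> (U w) \<partial>M)" by (subst nn_integral_distr) auto
  finally show ?thesis .
qed

text \<open>Instead of a first-passage decomposition, the partial sums are frozen once they leave
  \<open>(- l, l)\<close>; the frozen sums still have orthogonal increments.\<close>

lemma (in prob_space) martingale_difference_maximal_inequality:
  fixes X :: "nat \<Rightarrow> 'a \<Rightarrow> real" and G :: "nat \<Rightarrow> 'a measure"
  assumes G: "\<And>n. subalgebra M (G n)" "\<And>n. sets (G n) \<subseteq> sets (G (Suc n))"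
    and X: "\<And>n. X n \<in> borel_measurable (G (Suc n))"
    and X2: "\<And>n. integrable M (\<lambda>w. (X n w)\<^sup>2)"
    and orth: "\<And>n W c. W \<in> borel_measurable (G n) \<Longrightarrow> (\<And>w. \<bar>W w\<bar> \<le> c) \<Longrightarrow>
       expectation (\<lambda>w. W w * X n w) = 0"
    and l: "0 < l"
  shows "prob {w \<in> space M. \<exists>i\<le>n. l \<le> \<bar>\<Sum>k<i. X k w\<bar>} \<le> (\<Sum>k<n. expectation (\<lambda>w. (X k w)\<^sup>2)) / l\<^sup>2"
proof -
  have XM[measurable]: "X n \<in> borel_measurable M" for n
    by (rule measurable_from_subalg[OF G(1) X])
  have Xint: "integrable M (X n)" for n
    by (rule square_integrable_imp_integrable[OF XM X2])
  define T where "T = rec_nat (\<lambda>w. 0) (\<lambda>n t w. t w + (if \<bar>t w\<bar> < l then X n w else 0))"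
  have T0: "T 0 w = 0" for w by (simp add: T_def)
  have TS: "T (Suc n) w = T n w + (if \<bar>T n w\<bar> < l then X n w else 0)" for n w
    by (simp add: T_def)
  have Tm: "T n \<in> borel_measurable (G n)" for n
  proof (induction n)
    case 0
    show ?case by (simp add: T_def)
  next
    case (Suc n)
    have "subalgebra (G (Suc n)) (G n)"
      using G(1)[of n] G(1)[of "Suc n"] G(2)[of n] by (simp add: subalgebra_def)
    then have [measurable]: "T n \<in> borel_measurable (G (Suc n))"
      using Suc by (rule measurable_from_subalg)
    note [measurable] = X[of n]
    have "T (Suc n) = (\<lambda>w. T n w + (if \<bar>T n w\<bar> < l then X n w else 0))" using TS by auto
    then show ?case by simp
  qed
  have TM[measurable]: "T n \<in> borel_measurable M" for n
    by (rule measurable_from_subalg[OF G(1) Tm])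
  have step: "integrable M (\<lambda>w. (T n w)\<^sup>2) \<and>
      expectation (\<lambda>w. (T n w)\<^sup>2) \<le> (\<Sum>k<n. expectation (\<lambda>w. (X k w)\<^sup>2))" for n
  proof (induction n)
    case 0
    show ?case by (simp add: T0)
  next
    case (Suc n)
    \<comment> \<open>\<open>W\<close> is half the coefficient of \<open>X n\<close> in the cross
      term of the squared frozen sum. Freezing bounds it by \<open>l\<close>, and
      \<open>orth\<close> speaks of bounded weights only.\<close>
    define W where "W w = (if \<bar>T n w\<bar> < l then T n w else 0)" for w
    have W: "W \<in> borel_measurable (G n)" unfolding W_def using Tm[of n] by measurable
    have Wl: "\<bar>W w\<bar> \<le> l" for w using l by (simp add: W_def)
    have [measurable]: "W \<in> borel_measurable M" by (rule measurable_from_subalg[OF G(1) W])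
    have WX: "integrable M (\<lambda>w. W w * X n w)"
    proof (rule Bochner_Integration.integrable_bound)
      show "integrable M (\<lambda>w. l * X n w)" using Xint by simp
      show "AE w in M. norm (W w * X n w) \<le> norm (l * X n w)"
        using Wl l by (auto simp: abs_mult intro!: mult_right_mono)
    qed simp
    have IX: "integrable M (\<lambda>w. if \<bar>T n w\<bar> < l then (X n w)\<^sup>2 else 0)"
      by (rule Bochner_Integration.integrable_bound[OF X2[of n]]) auto
    have sq: "(T (Suc n) w)\<^sup>2 =
        (T n w)\<^sup>2 + 2 * (W w * X n w) + (if \<bar>T n w\<bar> < l then (X n w)\<^sup>2 else 0)" for w
      by (simp add: TS W_def power2_sum)
    have "expectation (\<lambda>w. (T (Suc n) w)\<^sup>2) =
        expectation (\<lambda>w. (T n w)\<^sup>2) + 2 * expectation (\<lambda>w. W w * X n w)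
        + expectation (\<lambda>w. if \<bar>T n w\<bar> < l then (X n w)\<^sup>2 else 0)"
      unfolding sq using Suc WX IX by simp
    also have "expectation (\<lambda>w. W w * X n w) = 0" by (rule orth[OF W Wl])
    also have "expectation (\<lambda>w. if \<bar>T n w\<bar> < l then (X n w)\<^sup>2 else 0) \<le> expectation (\<lambda>w. (X n w)\<^sup>2)"
      by (intro integral_mono IX X2) auto
    finally show ?case unfolding sq using Suc WX IX by simp
  qed
  \<comment> \<open>By induction, either no partial sum has reached \<open>l\<close> and
    \<open>T\<close> is the true sum, or \<open>T\<close> is frozen at a value of modulus at least
    \<open>l\<close>. A later return of the true sums therefore does not matter.\<close>
  have hit: "l \<le> \<bar>T n w\<bar>" if "i \<le> n" "l \<le> \<bar>\<Sum>k<i. X k w\<bar>" for i n w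
  proof -
    have "(T n w = (\<Sum>k<n. X k w) \<and> (\<forall>i\<le>n. \<bar>\<Sum>k<i. X k w\<bar> < l)) \<or> l \<le> \<bar>T n w\<bar>" for n
    proof (induction n)
      case 0
      show ?case using l by (simp add: T0)
    next
      case (Suc n)
      then show ?case by (auto simp: TS le_Suc_eq not_less)
    qed
    then show ?thesis using that by (meson not_less)
  qed
  have "prob {w \<in> space M. \<exists>i\<le>n. l \<le> \<bar>\<Sum>k<i. X k w\<bar>} \<le> prob {w \<in> space M. l \<le> \<bar>T n w\<bar>}"
    using hit by (intro finite_measure_mono) auto
  also have "\<dots> \<le> expectation (\<lambda>w. (T n w)\<^sup>2) / l\<^sup>2"
    by (rule second_moment_method) (use step[of n] l in auto)
  also have "\<dots> \<le> (\<Sum>k<n. expectation (\<lambda>w. (X k w)\<^sup>2)) / l\<^sup>2"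
    using step by (intro divide_right_mono) auto
  finally show ?thesis .
qed

text \<open>The maximal inequality for the sequence shifted by \<open>N\<close> bounds the
  probability of an oscillation after \<open>N\<close> by a tail of the variance series. Letting
  \<open>N\<close> grow and taking countably many levels makes the partial sums Cauchy almost
  surely.\<close>

lemma (in prob_space) martingale_difference_convergent:
  fixes X :: "nat \<Rightarrow> 'a \<Rightarrow> real" and G :: "nat \<Rightarrow> 'a measure"
  assumes G: "\<And>n. subalgebra M (G n)" "\<And>n. sets (G n) \<subseteq> sets (G (Suc n))"
    and X: "\<And>n. X n \<in> borel_measurable (G (Suc n))"
    and X2: "\<And>n. integrable M (\<lambda>w. (X n w)\<^sup>2)"
    and orth: "\<And>n W c. W \<in> borel_measurable (G n) \<Longrightarrow> (\<And>w. \<bar>W w\<bar> \<le> c) \<Longrightarrow>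
       expectation (\<lambda>w. W w * X n w) = 0"
    and summ: "summable (\<lambda>n. expectation (\<lambda>w. (X n w)\<^sup>2))"
  shows "AE w in M. convergent (\<lambda>n. \<Sum>k<n. X k w)"
proof -
  have XM[measurable]: "X n \<in> borel_measurable M" for n
    by (rule measurable_from_subalg[OF G(1) X])
  define e where "e n = expectation (\<lambda>w. (X n w)\<^sup>2)" for n
  have e0: "0 \<le> e n" for n by (simp add: e_def)
  have tail: "prob {w \<in> space M. \<exists>i. l \<le> \<bar>\<Sum>k<i. X (k + N) w\<bar>} \<le> (\<Sum>k. e (k + N)) / l\<^sup>2"
    if l: "0 < l" for N l
  proof -
    define E where "E n = {w \<in> space M. \<exists>i\<le>n. l \<le> \<bar>\<Sum>k<i. X (k + N) w\<bar>}" for n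
    have "prob (E n) \<le> (\<Sum>k. e (k + N)) / l\<^sup>2" for n
    proof -
      have "prob (E n) \<le> (\<Sum>k<n. e (k + N)) / l\<^sup>2"
        unfolding E_def e_def
        by (rule martingale_difference_maximal_inequality[where G = "\<lambda>n. G (n + N)"])
           (use G X X2 l in \<open>auto intro: orth\<close>)
      also have "\<dots> \<le> (\<Sum>k. e (k + N)) / l\<^sup>2"
        using summ e0 unfolding e_def[symmetric]
        by (intro divide_right_mono sum_le_suminf) (auto simp: summable_iff_shift)
      finally show ?thesis .
    qed
    moreover have "(\<lambda>n. prob (E n)) \<longlonglongrightarrow> prob (\<Union>n. E n)"
      unfolding E_def by (intro finite_Lim_measure_incseq) (auto simp: incseq_def intro: order_trans)
    ultimately have "prob (\<Union>n. E n) \<le> (\<Sum>k. e (k + N)) / l\<^sup>2"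
      by (intro LIMSEQ_le_const2) auto
    also have "(\<Union>n. E n) = {w \<in> space M. \<exists>i. l \<le> \<bar>\<Sum>k<i. X (k + N) w\<bar>}"
      by (auto simp: E_def)
    finally show ?thesis .
  qed
  have "AE w in M. \<exists>N. \<forall>i. \<bar>\<Sum>k<i. X (k + N) w\<bar> < l" if l: "0 < l" for l
  proof -
    define Z where "Z = {w \<in> space M. \<forall>N. \<exists>i. l \<le> \<bar>\<Sum>k<i. X (k + N) w\<bar>}"
    have [measurable]: "Z \<in> sets M" unfolding Z_def by measurable
    have "prob Z \<le> (\<Sum>k. e (k + N)) / l\<^sup>2" for N
      by (rule order_trans[OF finite_measure_mono tail[OF l]]) (auto simp: Z_def)
    moreover have "(\<lambda>N. (\<Sum>k. e (k + N)) / l\<^sup>2) \<longlonglongrightarrow> 0 / l\<^sup>2"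
      using summ unfolding e_def[symmetric] using l by (intro tendsto_divide suminf_exist_split2) auto
    ultimately have "prob Z \<le> 0" by (intro LIMSEQ_le_const[of _ 0]) auto
    then have "prob Z = 0" by (simp add: measure_le_0_iff)
    then have "AE w in M. w \<notin> Z" by (simp add: prob_eq_0)
    then show ?thesis by (auto simp: Z_def not_le elim!: AE_mp)
  qed
  then have "AE w in M. \<forall>p. \<exists>N. \<forall>i. \<bar>\<Sum>k<i. X (k + N) w\<bar> < inverse (real (Suc p))"
    by (subst AE_all_countable) auto
  then show ?thesis
  proof (rule AE_mp, intro AE_I2 impI)
    fix w assume *: "\<forall>p. \<exists>N. \<forall>i. \<bar>\<Sum>k<i. X (k + N) w\<bar> < inverse (real (Suc p))"
    show "convergent (\<lambda>n. \<Sum>k<n. X k w)"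
    proof (rule Cauchy_convergent, rule CauchyI')
      fix r :: real assume "0 < r"
      then obtain p where p: "inverse (real (Suc p)) < r / 2"
        using reals_Archimedean[of "r / 2"] by auto
      obtain N where N: "\<And>i. \<bar>\<Sum>k<i. X (k + N) w\<bar> < inverse (real (Suc p))" using * by blast
      have diff: "\<bar>(\<Sum>k<n. X k w) - (\<Sum>k<N. X k w)\<bar> < r / 2" if "n \<ge> N" for n
      proof -
        have "(\<Sum>k<n. X k w) - (\<Sum>k<N. X k w) = (\<Sum>k<n - N. X (k + N) w)"
          using that sum.nat_group[of "\<lambda>k. X k w"]
            sum_diff_nat_ivl[of 0 N n "\<lambda>k. X k w"] sum.shift_bounds_nat_ivl[of "\<lambda>k. X k w" 0 N "n - N"]
          by (simp add: lessThan_atLeast0)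
        then show ?thesis using N[of "n - N"] p by simp
      qed
      show "\<exists>N. \<forall>m\<ge>N. \<forall>n>m. dist (\<Sum>k<m. X k w) (\<Sum>k<n. X k w) < r"
      proof (intro exI allI impI)
        fix m n assume "N \<le> m" "m < n"
        then have "N \<le> n" by simp
        with \<open>N \<le> m\<close> show "dist (\<Sum>k<m. X k w) (\<Sum>k<n. X k w) < r"
          using diff[of m] diff[of n] unfolding dist_real_def by linarith
      qed
    qed
  qed
qed

section \<open>Identification of the active constraints and the pathwise rate\<close>

text \<open>The projection \<open>p\<close> and the candidate \<open>y\<close>, which is
  \<open>xs\<close> plus the projected displacement, each satisfy a variational inequality directed
  at the other; adding the two gives |y - p|^2 <= 0. The inequality at \<open>y\<close> needs
  nonnegative multipliers, which the relative interior provides. The one at \<open>p\<close> needs a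
  feasible move from \<open>p\<close> towards \<open>y\<close>.\<close>

lemma closest_point_active_identification:
  fixes B :: "real ^ 'd ^ 'p" and C :: "real ^ 'd ^ 'q" and b c and z :: "nat \<Rightarrow> real ^ 'd"
  defines "X \<equiv> feasible_set B b C c"
  assumes xs: "B *v xs = b" "\<And>i. (C *v xs) $ i < c $ i"
    and v: "v \<in> rel_interior (active_normal_cone B)"
    and s: "filterlim s at_top sequentially"
    and z: "(\<lambda>n. z n /\<^sub>R s n) \<longlonglongrightarrow> v"
    and lim: "(\<lambda>n. closest_point X (z n)) \<longlonglongrightarrow> xs"
  shows "\<forall>\<^sub>F n in sequentially. closest_point X (z n) = xs + proj_ker B *v (z n - xs)"
proof -
  let ?N = "active_normal_cone B" and ?P = "proj_ker B"
  have "xs \<in> X" using xs by (simp add: X_def feasible_set_iff less_imp_le)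
  then have X: "closed X" "convex X" "X \<noteq> {}"
    using closed_feasible_set convex_feasible_set by (auto simp: X_def)
  obtain e where e: "e > 0" "ball v e \<inter> affine hull ?N \<subseteq> ?N"
    using v by (auto simp: mem_rel_interior_ball)
  have vN: "v \<in> ?N" using v rel_interior_subset by blast
  then obtain lv where lv: "v = transpose B *v lv" by (auto simp: active_normal_cone_def)
  have "0 \<in> ?N" unfolding active_normal_cone_def
    by (auto intro!: exI[of _ 0])
  then have hull: "affine hull ?N = span ?N"
    by (intro affine_hull_span_0 hull_inc)
  \<comment> \<open>The cone spans the whole range of B^T, as any \<open>l\<close> is the difference
    of its positive and negative parts. As \<open>v\<close> is a relative interior point, small
    perturbations of it within that range stay in the cone.\<close>
  have range_hull: "transpose B *v l \<in> affine hull ?N" for l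
  proof -
    define lp :: "real ^ 'p" where "lp = (\<chi> i. max 0 (l $ i))"
    define lm :: "real ^ 'p" where "lm = (\<chi> i. max 0 (- l $ i))"
    have "0 \<le> lp" "0 \<le> lm" by (simp_all add: lp_def lm_def less_eq_vec_def)
    then have "transpose B *v lp \<in> ?N" "transpose B *v lm \<in> ?N"
      by (auto simp: active_normal_cone_def simp del: transpose_matrix_vector)
    then have "transpose B *v lp - transpose B *v lm \<in> span ?N"
      by (intro span_diff span_base)
    also have "transpose B *v lp - transpose B *v lm = transpose B *v l"
    proof -
      have "lp - lm = l" by (auto simp: vec_eq_iff lp_def lm_def)
      then show ?thesis by (simp only: matrix_vector_mult_diff_distrib[symmetric])
    qed
    finally show ?thesis by (simp only: hull)
  qed
  \<comment> \<open>The component of \<open>z n - xs\<close> in the range of B^T. Dividing by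
    \<open>s n\<close> removes \<open>xs\<close>, and \<open>proj_ker\<close> annihilates
    \<open>v\<close>, so the quotient tends to \<open>v\<close>.\<close>
  define u where "u n = (z n - xs) - ?P *v (z n - xs)" for n
  have "(\<lambda>n. u n /\<^sub>R s n) \<longlonglongrightarrow> (v - 0) - ?P *v (v - 0)"
  proof -
    have "(\<lambda>n. inverse (s n)) \<longlonglongrightarrow> 0"
      by (rule tendsto_inverse_0_at_top[OF s])
    then have "(\<lambda>n. inverse (s n) *\<^sub>R xs) \<longlonglongrightarrow> 0 *\<^sub>R xs" by (intro tendsto_intros)
    then have "(\<lambda>n. z n /\<^sub>R s n - inverse (s n) *\<^sub>R xs) \<longlonglongrightarrow> v - 0"
      using z by (intro tendsto_diff) auto
    moreover from this have "(\<lambda>n. ?P *v (z n /\<^sub>R s n - inverse (s n) *\<^sub>R xs)) \<longlonglongrightarrow> ?P *v (v - 0)"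
      by (rule bounded_linear.tendsto[OF matrix_vector_mul_bounded_linear])
    ultimately have "(\<lambda>n. (z n /\<^sub>R s n - inverse (s n) *\<^sub>R xs) - ?P *v (z n /\<^sub>R s n - inverse (s n) *\<^sub>R xs))
        \<longlonglongrightarrow> (v - 0) - ?P *v (v - 0)"
      by (rule tendsto_diff)
    then show ?thesis
      by (simp add: u_def scaleR_diff_right[symmetric] matrix_vector_mult_scaleR)
  qed
  also have "(v - 0) - ?P *v (v - 0) = v"
    by (simp add: lv proj_ker_range_transpose del: transpose_matrix_vector)
  finally have "\<forall>\<^sub>F n in sequentially. dist (u n /\<^sub>R s n) v < e"
    using e(1) by (rule tendstoD)
  moreover have "\<forall>\<^sub>F n in sequentially. s n > 0"
    using s by (simp add: filterlim_at_top_dense)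
  moreover have "\<forall>\<^sub>F n in sequentially. \<forall>i. (C *v closest_point X (z n)) $ i < c $ i"
  proof (rule eventually_all_finite)
    fix i
    have "(\<lambda>n. (C *v closest_point X (z n)) $ i) \<longlonglongrightarrow> (C *v xs) $ i"
      by (intro tendsto_vec_nth bounded_linear.tendsto[OF matrix_vector_mul_bounded_linear] lim)
    then show "\<forall>\<^sub>F n in sequentially. (C *v closest_point X (z n)) $ i < c $ i"
      using xs(2) by (rule order_tendstoD)
  qed
  ultimately show ?thesis
  proof eventually_elim
    case (elim n)
    define p where "p = closest_point X (z n)"
    define y where "y = xs + ?P *v (z n - xs)"
    obtain l0 where l0: "u n = transpose B *v l0"
      unfolding u_def by (rule proj_ker_complement)
    have "u n /\<^sub>R s n = transpose B *v (l0 /\<^sub>R s n)" by (simp only: l0 matrix_vector_mult_scaleR)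
    then have "u n /\<^sub>R s n \<in> affine hull ?N" using range_hull by simp
    moreover have "u n /\<^sub>R s n \<in> ball v e" using elim by (simp add: dist_commute)
    ultimately have "u n /\<^sub>R s n \<in> ?N" using e(2) by blast
    then obtain l1 where l1: "0 \<le> l1" "u n /\<^sub>R s n = transpose B *v l1"
      by (auto simp: active_normal_cone_def)
    define l where "l = s n *\<^sub>R l1"
    have "u n = s n *\<^sub>R (u n /\<^sub>R s n)" using elim by simp
    then have u: "u n = transpose B *v l"
      by (simp only: l1(2) l_def matrix_vector_mult_scaleR)
    have l: "0 \<le> l $ i" for i using l1(1) elim by (simp add: l_def less_eq_vec_def)
    have By: "B *v y = b" by (simp add: y_def matrix_vector_right_distrib mult_proj_ker xs)
    have p: "p \<in> X" unfolding p_def using X by (intro closest_point_in_set)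
    have Bp: "(B *v p) $ i \<le> b $ i" for i using p by (simp add: X_def feasible_set_iff)
    have zy: "z n - y = u n" by (simp add: y_def u_def)
    have "(z n - y) \<bullet> (p - y) = l \<bullet> (B *v p - b)"
      by (simp only: zy u inner_transpose_mult matrix_vector_mult_diff_distrib By)
    also have "\<dots> \<le> 0"
      unfolding inner_vec_def using l Bp by (intro sum_nonpos) (simp add: mult_nonneg_nonpos)
    finally have 1: "(z n - y) \<bullet> (p - y) \<le> 0" .
    \<comment> \<open>\<open>y\<close> itself is not known to satisfy the constraints given by
      \<open>C\<close>. They are strict at \<open>p\<close>, however, so a short move from
      \<open>p\<close> towards \<open>y\<close> stays feasible, and the variational inequality
      scales linearly in \<open>r\<close>.\<close>
    have "\<forall>\<^sub>F r in at_right 0. \<forall>i. (C *v (p + r *\<^sub>R (y - p))) $ i < c $ i"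
    proof (rule eventually_all_finite)
      fix i
      have "((\<lambda>r. (C *v (p + r *\<^sub>R (y - p))) $ i) \<longlongrightarrow> (C *v (p + 0 *\<^sub>R (y - p))) $ i) (at_right 0)"
        by (intro tendsto_vec_nth bounded_linear.tendsto[OF matrix_vector_mul_bounded_linear]
            tendsto_intros)
      then show "\<forall>\<^sub>F r in at_right 0. (C *v (p + r *\<^sub>R (y - p))) $ i < c $ i"
        using elim unfolding p_def by (intro order_tendstoD) auto
    qed
    moreover have "\<forall>\<^sub>F r::real in at_right 0. 0 < r \<and> r < 1"
      using eventually_at_right_real[of 0 1] by simp
    ultimately have "\<forall>\<^sub>F r in at_right 0. (\<forall>i. (C *v (p + r *\<^sub>R (y - p))) $ i < c $ i) \<and> 0 < r \<and> r < (1::real)"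
      by (rule eventually_conj)
    from eventually_happens[OF this]
    obtain r :: real where r: "\<And>i. (C *v (p + r *\<^sub>R (y - p))) $ i < c $ i" "0 < r" "r < 1"
      by (auto simp: trivial_limit_at_right_real)
    have "(B *v (p + r *\<^sub>R (y - p))) $ i \<le> b $ i" for i
    proof -
      have "(B *v (p + r *\<^sub>R (y - p))) $ i = (1 - r) * (B *v p) $ i + r * b $ i"
        by (simp add: matrix_vector_right_distrib matrix_vector_mult_scaleR
            matrix_vector_mult_diff_distrib By algebra_simps)
      also have "\<dots> \<le> (1 - r) * b $ i + r * b $ i"
        using Bp r by (intro add_right_mono mult_left_mono) auto
      finally show ?thesis by (simp add: algebra_simps)
    qed
    then have "p + r *\<^sub>R (y - p) \<in> X" using r by (simp add: X_def feasible_set_iff less_imp_le)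
    then have "(z n - p) \<bullet> (p + r *\<^sub>R (y - p) - p) \<le> 0"
      unfolding p_def using X by (intro closest_point_dot)
    then have "r * ((z n - p) \<bullet> (y - p)) \<le> 0" by simp
    then have 2: "(z n - p) \<bullet> (y - p) \<le> 0" using r(2) by (simp add: mult_le_0_iff)
    have "(y - p) \<bullet> (y - p) = (z n - y) \<bullet> (p - y) + (z n - p) \<bullet> (y - p)"
      by (simp add: inner_diff_left inner_diff_right inner_commute)
    with 1 2 have "(y - p) \<bullet> (y - p) \<le> 0" by simp
    then have "y = p" by (metis inner_gt_zero_iff not_less right_minus_eq)
    then show ?case by (simp add: p_def y_def)
  qed
qed

text \<open>Scaling by \<open>\<beta>\<close> and subtracting the tails of the convergent noise series leaves a contraction
  with vanishing perturbation.\<close>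

lemma stochastic_recursion_rate:
  fixes D :: "nat \<Rightarrow> 'a::real_inner"
  assumes K: "bounded_linear K" and c: "0 < c" "\<And>y. c * (norm y)\<^sup>2 \<le> y \<bullet> K y"
    and rec: "\<forall>\<^sub>F k in sequentially. D (Suc k) = D k - t k *\<^sub>R (K (D k) + r k) - w k"
    and r: "\<forall>\<^sub>F k in sequentially. norm (r k) \<le> c1 * (norm (D k))\<^sup>2 + e k"
    and c1: "0 \<le> c1"
    and e: "(\<lambda>k. e k / \<beta> k) \<longlonglongrightarrow> 0"
    and D: "D \<longlonglongrightarrow> 0"
    and t: "\<And>k. 0 \<le> t k" "t \<longlonglongrightarrow> 0" "filterlim (\<lambda>n. \<Sum>k<n. t k) at_top sequentially"
    and \<beta>: "\<And>k. 0 < \<beta> k" "\<And>k. \<beta> (Suc k) \<le> \<beta> k" "\<And>k. \<beta> k / \<beta> (Suc k) \<le> 1 + q k * t k"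
    and q: "\<And>k. 0 \<le> q k" "q \<longlonglongrightarrow> 0"
    and w: "summable (\<lambda>k. w k /\<^sub>R \<beta> (Suc k))"
  shows "(\<lambda>k. norm (D k) / \<beta> k) \<longlonglongrightarrow> 0"
proof -
  interpret K: bounded_linear K by (rule K)
  obtain \<kappa> where \<kappa>: "0 < \<kappa>" "\<And>y. norm (K y) \<le> norm y * \<kappa>" using K.pos_bounded by blast
  define n where "n k = w k /\<^sub>R \<beta> (Suc k)" for k
  \<comment> \<open>Since \<open>N k - N (Suc k) = n k\<close>, passing from \<open>U\<close> to
    \<open>V = U - N\<close> cancels the noise of each step exactly. \<open>N k\<close> survives
    only with a factor \<open>\<omega> k - 1\<close> or of order \<open>t k\<close>, so it counts as
    a vanishing perturbation.\<close>
  define N where "N k = (\<Sum>l. n l) - (\<Sum>l<k. n l)" for k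
  define U where "U k = D k /\<^sub>R \<beta> k" for k
  define V where "V k = U k - N k" for k
  define \<omega> where "\<omega> k = \<beta> k / \<beta> (Suc k)" for k
  have N: "N \<longlonglongrightarrow> 0"
    using tendsto_diff[OF tendsto_const summable_LIMSEQ[OF w[folded n_def]], of "suminf n"]
    unfolding N_def by simp
  have NS: "N k = N (Suc k) + n k" for k by (simp add: N_def)
  have \<omega>1: "1 \<le> \<omega> k" for k using \<beta>(1)[of "Suc k"] \<beta>(2)[of k] by (simp add: \<omega>_def)
  \<comment> \<open>Bounds whatever in the recursion is not proportional to
    \<open>norm (V k)\<close>, per unit of \<open>t k\<close>; the factor 2 stands for the eventual
    bound on \<open>\<omega> k\<close>.\<close>
  define s where "s k = q k * norm (N k)
      + 2 * (\<kappa> * norm (N k) + c1 * norm (D k) * norm (N k) + e k / \<beta> k)" for k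
  have "s \<longlonglongrightarrow> 0 * 0 + 2 * (\<kappa> * 0 + c1 * 0 * 0 + 0)"
    unfolding s_def using N D e q(2) by (intro tendsto_intros) (auto intro: tendsto_norm_zero)
  then have s: "(\<lambda>k. 4 / c * s k) \<longlonglongrightarrow> 0"
    using tendsto_mult_left[of s 0 sequentially "4 / c"] by simp
  \<comment> \<open>Coercivity gains \<open>2 * c * h\<close>, the second-order term costs at most
    \<open>c * h\<close>, and 1 - c h <= (1 - c h / 2)^2.\<close>
  have contr: "norm (y - h *\<^sub>R K y) \<le> (1 - c * h / 2) * norm y"
    if h: "0 \<le> h" "h * \<kappa>\<^sup>2 \<le> c" "c * h \<le> 2" for h y
  proof (rule power2_le_imp_le)
    have "(norm (y - h *\<^sub>R K y))\<^sup>2 = (norm y)\<^sup>2 - 2 * h * (y \<bullet> K y) + h\<^sup>2 * (norm (K y))\<^sup>2"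
      by (simp only: power2_norm_eq_inner) (simp add: inner_diff_left inner_diff_right inner_commute
          power2_eq_square algebra_simps)
    also have "\<dots> \<le> (norm y)\<^sup>2 - 2 * h * (c * (norm y)\<^sup>2) + h\<^sup>2 * (norm y * \<kappa>)\<^sup>2"
      using h c \<kappa> by (intro add_mono diff_mono mult_left_mono power_mono) auto
    also have "\<dots> = (1 - 2 * c * h + h * (h * \<kappa>\<^sup>2)) * (norm y)\<^sup>2"
      by (simp add: power2_eq_square algebra_simps)
    also have "\<dots> \<le> (1 - 2 * c * h + h * c) * (norm y)\<^sup>2"
      using h by (intro mult_right_mono add_left_mono mult_left_mono) auto
    also have "\<dots> \<le> (1 - c * h / 2)\<^sup>2 * (norm y)\<^sup>2"
      using c(1) h(1) by (intro mult_right_mono) (auto simp: power2_eq_square algebra_simps)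
    finally show "(norm (y - h *\<^sub>R K y))\<^sup>2 \<le> ((1 - c * h / 2) * norm y)\<^sup>2"
      by (simp add: power_mult_distrib)
    show "0 \<le> (1 - c * h / 2) * norm y" using h by simp
  qed
  \<comment> \<open>The contraction rate is \<open>c / 2\<close> per unit of \<open>t\<close>; the
    growth \<open>q k\<close> from rescaling and the quadratic remainder may use up half of it,
    which leaves the rate \<open>c / 4\<close>.\<close>
  have ev_t: "\<forall>\<^sub>F k in sequentially. t k * \<kappa>\<^sup>2 < c \<and> c * t k < 2 \<and> q k * t k < 1
      \<and> q k + 2 * c1 * norm (D k) < c / 4"
  proof (intro eventually_conj)
    have "(\<lambda>k. t k * \<kappa>\<^sup>2) \<longlonglongrightarrow> 0" "(\<lambda>k. c * t k) \<longlonglongrightarrow> 0" "(\<lambda>k. q k * t k) \<longlonglongrightarrow> 0"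
      "(\<lambda>k. q k + 2 * c1 * norm (D k)) \<longlonglongrightarrow> 0"
      using t(2) q(2) D by (auto intro!: tendsto_eq_intros)
    note lims = this
    show "\<forall>\<^sub>F k in sequentially. t k * \<kappa>\<^sup>2 < c"
      by (rule order_tendstoD(2)[OF lims(1)]) (use c in simp)
    show "\<forall>\<^sub>F k in sequentially. c * t k < 2"
      by (rule order_tendstoD(2)[OF lims(2)]) simp
    show "\<forall>\<^sub>F k in sequentially. q k * t k < 1"
      by (rule order_tendstoD(2)[OF lims(3)]) simp
    show "\<forall>\<^sub>F k in sequentially. q k + 2 * c1 * norm (D k) < c / 4"
      by (rule order_tendstoD(2)[OF lims(4)]) (use c in simp)
  qed
  have "(\<lambda>k. norm (V k)) \<longlonglongrightarrow> 0"
  proof (rule perturbed_contraction_tendsto_0[where t = "\<lambda>k. c / 4 * t k" and s = "\<lambda>k. 4 / c * s k"])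
    show "\<forall>\<^sub>F k in sequentially. 0 \<le> c / 4 * t k \<and> c / 4 * t k \<le> 1"
      using ev_t by eventually_elim (use c t(1) in auto)
    have "filterlim (\<lambda>n. c / 4 * (\<Sum>k<n. t k)) at_top sequentially"
      by (rule filterlim_tendsto_pos_mult_at_top[OF tendsto_const _ t(3)]) (use c in simp)
    then show "filterlim (\<lambda>n. \<Sum>k<n. c / 4 * t k) at_top sequentially"
      by (simp add: sum_distrib_left)
    show "\<forall>\<^sub>F k in sequentially. norm (V (Suc k)) \<le> (1 - c / 4 * t k) * norm (V k) + c / 4 * t k * (4 / c * s k)"
      using ev_t rec r
    proof eventually_elim
      case (elim k)
      have \<beta>0: "0 < \<beta> k" "0 < \<beta> (Suc k)" using \<beta> by auto
      have \<omega>2: "\<omega> k \<le> 1 + q k * t k" "\<omega> k \<le> 2"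
        using \<beta>(3)[of k] elim by (auto simp: \<omega>_def)
      have DU: "D k = \<beta> k *\<^sub>R U k" using \<beta>0 by (simp add: U_def)
      have "U (Suc k) = (D k - t k *\<^sub>R (K (D k) + r k) - w k) /\<^sub>R \<beta> (Suc k)"
        by (simp only: U_def elim(2))
      also have "\<dots> = \<omega> k *\<^sub>R (U k - t k *\<^sub>R K (U k) - (t k / \<beta> k) *\<^sub>R r k) - n k"
      proof -
        have cancel: "\<beta> k * (inverse (\<beta> k) * y) = y" "\<beta> k * (y * (inverse (\<beta> k) * y')) = y * y'" for y y'
          using \<beta>0 by auto
        show ?thesis
          by (simp add: cancel U_def n_def \<omega>_def K.scaleR scaleR_diff_right scaleR_add_right divide_inverse
            mult.commute mult.left_commute)
      qed
      finally have "U (Suc k) = \<omega> k *\<^sub>R (U k - t k *\<^sub>R K (U k) - (t k / \<beta> k) *\<^sub>R r k) - n k" .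
      then have "V (Suc k) = \<omega> k *\<^sub>R (V k - t k *\<^sub>R K (V k)) + (\<omega> k - 1) *\<^sub>R N k
          - (\<omega> k * t k) *\<^sub>R (K (N k) + r k /\<^sub>R \<beta> k)"
        using NS[of k]
        by (simp add: V_def K.diff scaleR_diff_right scaleR_add_right scaleR_diff_left algebra_simps
            divide_inverse)
      then have "norm (V (Suc k)) \<le> \<omega> k * norm (V k - t k *\<^sub>R K (V k)) + (\<omega> k - 1) * norm (N k)
          + (\<omega> k * t k) * (norm (K (N k)) + norm (r k) / \<beta> k)"
        using \<omega>1[of k] t(1)[of k] \<beta>0
        by (auto intro!: order_trans[OF norm_triangle_ineq4] order_trans[OF norm_triangle_ineq]
            add_mono mult_left_mono simp: divide_inverse_commute)
      also have "\<dots> \<le> (1 + q k * t k) * ((1 - c * t k / 2) * norm (V k)) + (q k * t k) * norm (N k)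
          + (2 * t k) * (\<kappa> * norm (N k) + (c1 * norm (D k) * (norm (V k) + norm (N k)) + e k / \<beta> k))"
      proof (intro add_mono mult_mono \<omega>2)
        show "norm (V k - t k *\<^sub>R K (V k)) \<le> (1 - c * t k / 2) * norm (V k)"
          using elim t(1)[of k] by (intro contr) auto
        show "norm (K (N k)) \<le> \<kappa> * norm (N k)" using \<kappa>(2)[of "N k"] by (simp add: mult.commute)
        \<comment> \<open>One factor \<open>norm (D k)\<close> is kept as a small coefficient and
          the other is rescaled to \<open>norm (U k)\<close>, so the quadratic term acts as a small
          linear one.\<close>
        have "norm (r k) / \<beta> k \<le> c1 * norm (D k) * norm (U k) + e k / \<beta> k"
          using elim(3) \<beta>0 by (simp add: U_def field_simps power2_eq_square)
        also have "\<dots> \<le> c1 * norm (D k) * (norm (V k) + norm (N k)) + e k / \<beta> k"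
          using c1 norm_triangle_ineq[of "V k" "N k"]
          by (intro add_right_mono mult_left_mono) (auto simp: V_def)
        finally show "norm (r k) / \<beta> k \<le> c1 * norm (D k) * (norm (V k) + norm (N k)) + e k / \<beta> k" .
      qed (use \<omega>1[of k] \<omega>2 t(1)[of k] q(1)[of k] \<beta>0 in auto)
      also have "\<dots> \<le> (1 - c / 4 * t k) * norm (V k) + t k * s k"
      proof -
        have "(1 + q k * t k) * (1 - c * t k / 2) + 2 * t k * (c1 * norm (D k)) \<le> 1 - c / 4 * t k"
        proof -
          have "t k * (q k + 2 * c1 * norm (D k)) \<le> t k * (c / 4)"
            using elim t(1)[of k] by (intro mult_left_mono) auto
          moreover have "0 \<le> q k * t k * (c * t k / 2)" using q(1)[of k] t(1)[of k] c by simp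
          ultimately show ?thesis by (simp add: algebra_simps)
        qed
        then have "((1 + q k * t k) * (1 - c * t k / 2) + 2 * t k * (c1 * norm (D k))) * norm (V k)
            \<le> (1 - c / 4 * t k) * norm (V k)"
          by (rule mult_right_mono) simp
        then show ?thesis by (simp add: s_def algebra_simps)
      qed
      also have "t k * s k = c / 4 * t k * (4 / c * s k)" using c by simp
      finally show ?case .
    qed
  qed (use s in auto)
  then have "V \<longlonglongrightarrow> 0" by (rule tendsto_norm_zero_cancel)
  then have "(\<lambda>k. norm (V k + N k)) \<longlonglongrightarrow> 0" using N by (intro tendsto_norm_zero tendsto_add_zero)
  moreover have "norm (V k + N k) = norm (D k) / \<beta> k" for k
    using \<beta>(1)[of k] by (simp add: V_def U_def divide_inverse mult.commute)
  ultimately show ?thesis by simp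
qed

section \<open>Curvature on the kernel of \<open>B\<close>\<close>

lemma proj_ker_inner_complement: "(proj_ker B *v u) \<bullet> (v - proj_ker B *v v) = 0"
  for B :: "real ^ 'd ^ 'p"
proof -
  obtain l where "v - proj_ker B *v v = transpose B *v l" by (rule proj_ker_complement)
  then have "(proj_ker B *v u) \<bullet> (v - proj_ker B *v v) = (transpose B *v l) \<bullet> (proj_ker B *v u)"
    by (simp only: inner_commute)
  then show ?thesis by (simp only: inner_transpose_mult mult_proj_ker inner_zero_right)
qed

text \<open>Adding the identity on the orthogonal complement of the kernel makes the compressed Hessian
  coercive on the whole space, which spares tracking in which subspace the noise tails lie.\<close>

lemma compressed_Hessian_coercive:
  fixes B :: "real ^ 'd ^ 'p"
  assumes curv: "\<And>y. y \<in> critical_tangent_cone B \<Longrightarrow> \<mu> * (norm y)\<^sup>2 \<le> y \<bullet> (H *v y)"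
  defines "P \<equiv> proj_ker B"
  shows "min \<mu> 1 * (norm y)\<^sup>2 \<le> y \<bullet> (P *v (H *v (P *v y)) + (y - P *v y))"
proof -
  define p where "p = P *v y"
  define q where "q = y - p"
  have y: "y = p + q" by (simp add: q_def)
  have orth: "p \<bullet> (v - P *v v) = 0" for v unfolding p_def P_def by (rule proj_ker_inner_complement)
  have pq: "p \<bullet> q = 0" using orth[of y] by (simp add: q_def p_def)
  have qP: "q \<bullet> (P *v v) = 0" for v
    using proj_ker_inner_complement[of B v y] by (simp add: q_def p_def P_def inner_commute)
  have "y \<bullet> (P *v (H *v p) + q) = p \<bullet> (P *v (H *v p)) + q \<bullet> q"
    by (simp add: y inner_add_left inner_add_right qP pq inner_commute[of q p])
  also have "p \<bullet> (P *v (H *v p)) = p \<bullet> (H *v p)"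
    using orth[of "H *v p"] by (simp add: inner_diff_right)
  also have "p \<bullet> (H *v p) + q \<bullet> q \<ge> min \<mu> 1 * (norm p)\<^sup>2 + min \<mu> 1 * (norm q)\<^sup>2"
  proof (rule add_mono)
    have "min \<mu> 1 * (norm p)\<^sup>2 \<le> \<mu> * (norm p)\<^sup>2" by (intro mult_right_mono) auto
    also have "\<dots> \<le> p \<bullet> (H *v p)"
      by (intro curv) (simp add: critical_tangent_cone_def p_def P_def mult_proj_ker)
    finally show "min \<mu> 1 * (norm p)\<^sup>2 \<le> p \<bullet> (H *v p)" .
    have "min \<mu> 1 * (norm q)\<^sup>2 \<le> 1 * (norm q)\<^sup>2" by (intro mult_right_mono) auto
    then show "min \<mu> 1 * (norm q)\<^sup>2 \<le> q \<bullet> q" by (simp add: power2_norm_eq_inner)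
  qed
  also have "min \<mu> 1 * (norm p)\<^sup>2 + min \<mu> 1 * (norm q)\<^sup>2 = min \<mu> 1 * (norm y)\<^sup>2"
    by (simp add: y power2_norm_eq_inner inner_add_left inner_add_right pq inner_commute[of q p]
        algebra_simps)
  finally show ?thesis by (simp add: p_def q_def)
qed

section \<open>Step-size estimates and the rate along one trajectory\<close>

lemma sum_powr_at_top:
  assumes "0 < a" "0 < \<alpha>" "\<alpha> < 1"
  shows "filterlim (\<lambda>n. \<Sum>k<n. a / real (Suc k) powr \<alpha>) at_top sequentially"
proof (rule filterlim_at_top_mono)
  show "filterlim (\<lambda>n. a * real n powr (1 - \<alpha>)) at_top sequentially"
    using assms by real_asymp
  have "a * real n powr (1 - \<alpha>) \<le> (\<Sum>k<n. a / real (Suc k) powr \<alpha>)" for n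
  proof (cases "n = 0")
    case False
    have "a * real n powr (1 - \<alpha>) = (\<Sum>k<n. a / real n powr \<alpha>)"
      using False by (simp add: powr_diff)
    also have "\<dots> \<le> (\<Sum>k<n. a / real (Suc k) powr \<alpha>)"
      using assms by (intro sum_mono divide_left_mono powr_mono2) auto
    finally show ?thesis .
  qed simp
  then show "\<forall>\<^sub>F n in sequentially. a * real n powr (1 - \<alpha>) \<le> (\<Sum>k<n. a / real (Suc k) powr \<alpha>)"
    by simp
qed

text \<open>The quotient is (k+2)/(k+1) to the power \<open>\<alpha> * \<delta>\<close>, which is at
  most 1. The excess 1/(k+1) is of smaller order than the step-size because
  \<open>\<alpha> < 1\<close>, so rescaling costs less than the contraction gains.\<close>

lemma step_powr_ratio_le:
  assumes "0 < a" "0 < \<alpha>" "\<alpha> < 1" "0 < \<delta>" "\<delta> < 1"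
  shows "(a / real (Suc k) powr \<alpha>) powr \<delta> / (a / real (Suc (Suc k)) powr \<alpha>) powr \<delta> \<le> 1 + 1 / real (Suc k)"
proof -
  have "(a / real (Suc k) powr \<alpha>) powr \<delta> / (a / real (Suc (Suc k)) powr \<alpha>) powr \<delta>
      = (real (Suc (Suc k)) / real (Suc k)) powr (\<alpha> * \<delta>)"
    using assms by (simp add: powr_divide powr_powr)
  also have "\<dots> \<le> (real (Suc (Suc k)) / real (Suc k)) powr 1"
    using assms mult_le_one[of \<alpha> \<delta>] by (intro powr_mono) auto
  also have "\<dots> = 1 + 1 / real (Suc k)" by (simp add: field_simps)
  finally show ?thesis .
qed

text \<open>No probability is left: \<open>e\<close> is the consensus error and \<open>n\<close> the
  noise along one trajectory. The index is shifted: \<open>z k\<close> is zbar_k, \<open>s k\<close>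
  the step-size of step k + 1, and the projection of \<open>z k\<close> is xbar_(k+1). Plain
  summability of the noise serves the identification of the active constraints, the rescaled one the
  rate.\<close>

lemma dual_averaging_pathwise_rate:
  fixes B :: "real ^ 'd ^ 'p" and C :: "real ^ 'd ^ 'q" and b c and z e n :: "nat \<Rightarrow> real ^ 'd"
    and gradf :: "real ^ 'd \<Rightarrow> real ^ 'd" and m a \<alpha> \<delta> \<mu> c0 \<epsilon> :: real
  defines "X \<equiv> feasible_set B b C c" and "s \<equiv> \<lambda>k. a / real (Suc k) powr \<alpha>"
  assumes xs: "B *v xs = b" "\<And>i. (C *v xs) $ i < c $ i"
    and cq: "- gradf xs \<in> rel_interior (active_normal_cone B)"
    and expansion: "\<And>y. y \<in> X \<Longrightarrow> norm (y - xs) \<le> \<epsilon> \<Longrightarrow>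
      norm (gradf y - gradf xs - H *v (y - xs)) \<le> c0 * (norm (y - xs))\<^sup>2"
    and pos: "0 < c0" "0 < \<epsilon>" "0 < \<mu>" "0 < m" "0 < a"
    and curv: "\<And>y. y \<in> critical_tangent_cone B \<Longrightarrow> \<mu> * (norm y)\<^sup>2 \<le> y \<bullet> (H *v y)"
    and range: "0 < \<alpha>" "\<alpha> < 1" "0 < \<delta>" "\<delta> < 1"
    and rec: "\<And>k. z (Suc k) = z k - s k *\<^sub>R ((1 / m) *\<^sub>R gradf (closest_point X (z k)) + e k + n k)"
    and lim: "(\<lambda>k. closest_point X (z k)) \<longlonglongrightarrow> xs"
    and e: "(\<lambda>k. norm (e k) / s k powr \<delta>) \<longlonglongrightarrow> 0"
    and n: "summable (\<lambda>k. s k *\<^sub>R n k)" "summable (\<lambda>k. (s k / s (Suc k) powr \<delta>) *\<^sub>R n k)"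
  shows "(\<lambda>k. norm (proj_ker B *v (closest_point X (z k) - xs)) / s k powr \<delta>) \<longlonglongrightarrow> 0"
proof -
  let ?P = "proj_ker B"
  define Y where "Y k = closest_point X (z k)" for k
  have "xs \<in> X" using xs by (simp add: X_def feasible_set_iff less_imp_le)
  then have YX: "Y k \<in> X" for k
    unfolding Y_def by (intro closest_point_in_set) (auto simp: X_def closed_feasible_set)
  have Y: "Y \<longlonglongrightarrow> xs" using lim unfolding Y_def .
  have s0: "0 < s k" for k using pos by (simp add: s_def)
  have s_top: "filterlim (\<lambda>n. \<Sum>k<n. s k) at_top sequentially"
    unfolding s_def using pos range by (intro sum_powr_at_top) auto
  have s_lim: "s \<longlonglongrightarrow> 0" unfolding s_def using range by real_asymp
  have near: "\<forall>\<^sub>F k in sequentially. norm (Y k - xs) \<le> \<epsilon>"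
    using tendstoD[OF Y pos(2)] by eventually_elim (simp add: dist_norm)
  define R where "R k = gradf (Y k) - gradf xs - H *v (Y k - xs)" for k
  have R: "\<forall>\<^sub>F k in sequentially. norm (R k) \<le> c0 * (norm (Y k - xs))\<^sup>2"
    using near by eventually_elim (use expansion YX in \<open>simp add: R_def\<close>)
  have Y0: "(\<lambda>k. Y k - xs) \<longlonglongrightarrow> 0" using Y by (simp add: LIM_zero)
  have "R \<longlonglongrightarrow> 0"
  proof (rule Lim_null_comparison[OF R])
    have "(\<lambda>k. c0 * (norm (Y k - xs))\<^sup>2) \<longlonglongrightarrow> c0 * (norm (0 :: real ^ 'd))\<^sup>2"
      by (intro tendsto_intros Y0)
    then show "(\<lambda>k. c0 * (norm (Y k - xs))\<^sup>2) \<longlonglongrightarrow> 0" by simp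
  qed
  then have "(\<lambda>k. R k + H *v (Y k - xs)) \<longlonglongrightarrow> 0 + H *v 0"
    using Y0 by (intro tendsto_add bounded_linear.tendsto[OF matrix_vector_mul_bounded_linear])
  then have gY: "(\<lambda>k. gradf (Y k) - gradf xs) \<longlonglongrightarrow> 0" by (simp add: R_def)

  have "\<forall>\<^sub>F k in sequentially. Y k = xs + ?P *v (z k - xs)"
    unfolding Y_def X_def
  proof (rule closest_point_active_identification[OF xs cq])
    define S where "S n = (\<Sum>k<n. s k)" for n
    have S: "filterlim S at_top sequentially" using s_top unfolding S_def .
    show top: "filterlim (\<lambda>n. 1 / m * S n) at_top sequentially"
      by (rule filterlim_tendsto_pos_mult_at_top[OF tendsto_const _ S]) (use pos in simp)
    show "(\<lambda>k. closest_point (feasible_set B b C c) (z k)) \<longlonglongrightarrow> xs" using lim by (simp add: X_def)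
    define r where "r k = (1 / m) *\<^sub>R (gradf (Y k) - gradf xs) + e k" for k
    have "(\<lambda>k. norm (e k) / s k powr \<delta> * s k powr \<delta>) \<longlonglongrightarrow> 0 * 0 powr \<delta>"
      using s_lim s0 range by (intro tendsto_mult e tendsto_powr') (auto intro: always_eventually less_imp_le)
    then have "(\<lambda>k. norm (e k)) \<longlonglongrightarrow> 0" using s0 by (simp add: less_imp_neq[symmetric])
    then have "e \<longlonglongrightarrow> 0" by (rule tendsto_norm_zero_cancel)
    then have "r \<longlonglongrightarrow> (1 / m) *\<^sub>R 0 + 0" unfolding r_def using gY by (intro tendsto_intros)
    then have avg: "(\<lambda>n. (\<Sum>k<n. s k *\<^sub>R r k) /\<^sub>R S n) \<longlonglongrightarrow> 0"
      unfolding S_def using s0 s_top by (intro weighted_average_tendsto_0) (auto intro: less_imp_le)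
    have invS: "(\<lambda>n. inverse (S n)) \<longlonglongrightarrow> 0" by (rule tendsto_inverse_0_at_top[OF S])
    \<comment> \<open>The drift grows like \<open>S N\<close>, while the noise sum converges and the
      weighted average of \<open>r\<close> vanishes; only the drift survives division by
      \<open>S N / m\<close>.\<close>
    have z_sum: "z N = z 0 - (S N / m) *\<^sub>R gradf xs - (\<Sum>k<N. s k *\<^sub>R r k) - (\<Sum>k<N. s k *\<^sub>R n k)" for N
    proof (induction N)
      case 0
      show ?case by (simp add: S_def)
    next
      case (Suc N)
      have "z (Suc N) = z N - s N *\<^sub>R ((1 / m) *\<^sub>R gradf (Y N) + e N + n N)"
        by (simp add: rec Y_def)
      then show ?case
        unfolding Suc
        by (simp add: S_def r_def scaleR_add_left scaleR_add_right scaleR_diff_right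
            add_divide_distrib algebra_simps)
    qed
    have "(\<lambda>N. m *\<^sub>R (inverse (S N) *\<^sub>R z 0 - (1 / m) *\<^sub>R gradf xs - (\<Sum>k<N. s k *\<^sub>R r k) /\<^sub>R S N
        - inverse (S N) *\<^sub>R (\<Sum>k<N. s k *\<^sub>R n k))) \<longlonglongrightarrow>
        m *\<^sub>R (0 *\<^sub>R z 0 - (1 / m) *\<^sub>R gradf xs - 0 - 0 *\<^sub>R (\<Sum>k. s k *\<^sub>R n k))"
      by (intro tendsto_intros invS avg summable_LIMSEQ n)
    also have "m *\<^sub>R (0 *\<^sub>R z 0 - (1 / m) *\<^sub>R gradf xs - 0 - 0 *\<^sub>R (\<Sum>k. s k *\<^sub>R n k)) = - gradf xs"
      using pos by simp
    finally show "(\<lambda>N. z N /\<^sub>R (1 / m * S N)) \<longlonglongrightarrow> - gradf xs"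
    proof (rule Lim_transform_eventually)
      have "\<forall>\<^sub>F N in sequentially. S N > 0" using S by (simp add: filterlim_at_top_dense)
      then show "\<forall>\<^sub>F N in sequentially. m *\<^sub>R (inverse (S N) *\<^sub>R z 0 - (1 / m) *\<^sub>R gradf xs
          - (\<Sum>k<N. s k *\<^sub>R r k) /\<^sub>R S N - inverse (S N) *\<^sub>R (\<Sum>k<N. s k *\<^sub>R n k)) = z N /\<^sub>R (1 / m * S N)"
      proof eventually_elim
        case (elim N)
        show ?case using elim pos
          by (subst (2) z_sum) (simp add: scaleR_diff_right field_simps)
      qed
    qed
  qed
  then obtain K where K: "\<And>k. k \<ge> K \<Longrightarrow> Y k = xs + ?P *v (z k - xs)"
    unfolding eventually_sequentially by blast

  \<comment> \<open>From \<open>K\<close> on, \<open>D k\<close> is at once the error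
    \<open>Y k - xs\<close> and the projection of \<open>z k - xs\<close>. The second form inherits
    the recursion of \<open>z\<close>, the first feeds the expansion of the gradient.\<close>
  define D where "D k = ?P *v (Y k - xs)" for k
  have D_eq: "D k = Y k - xs" "D k = ?P *v (z k - xs)" if "k \<ge> K" for k
    using K[OF that] by (simp_all add: D_def proj_ker_kernel mult_proj_ker)
  have ev_K: "\<forall>\<^sub>F k in sequentially. k \<ge> K" by (rule eventually_ge_at_top)
  have P0: "?P *v gradf xs = 0"
  proof -
    have "- gradf xs \<in> active_normal_cone B" using cq rel_interior_subset by blast
    then obtain l where "- gradf xs = transpose B *v l" by (auto simp: active_normal_cone_def)
    then have "?P *v (- gradf xs) = 0" by (simp only: proj_ker_range_transpose)
    then show ?thesis using matrix_vector_mult_scaleR[of ?P "-1" "gradf xs"] by simp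
  qed
  \<comment> \<open>On \<open>D k\<close>, which lies in the kernel of \<open>B\<close>, the added
    complement term vanishes, so using \<open>F\<close> in place of the compressed Hessian does not
    alter the recursion.\<close>
  define F where "F y = ?P *v (H *v (?P *v y)) + (y - ?P *v y)" for y
  have F: "bounded_linear F"
    unfolding F_def
    by (intro bounded_linear_add bounded_linear_sub bounded_linear_ident
        bounded_linear_compose[OF matrix_vector_mul_bounded_linear] matrix_vector_mul_bounded_linear)
  define r where "r k = ?P *v R k + m *\<^sub>R (?P *v e k)" for k
  \<comment> \<open>\<open>q\<close> is chosen so that \<open>q k\<close> times \<open>t k\<close>
    is 1/(k+1), the bound on the growth of the rescaling. The time step is \<open>s k / m\<close>
    because \<open>gradf\<close> is a sum over the agents while \<open>z\<close> is an
    average.\<close>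
  have "(\<lambda>k. norm (D k) / s k powr \<delta>) \<longlonglongrightarrow> 0"
  proof (rule stochastic_recursion_rate[where K = F and c = "min \<mu> 1" and t = "\<lambda>k. s k / m" and r = r
        and ?c1.0 = c0 and e = "\<lambda>k. m * norm (e k)" and q = "\<lambda>k. 1 / real (Suc k) / (s k / m)"
        and w = "\<lambda>k. s k *\<^sub>R (?P *v n k)"])
    show "bounded_linear F" by (rule F)
    show "min \<mu> 1 * (norm y)\<^sup>2 \<le> y \<bullet> F y" for y
      unfolding F_def by (rule compressed_Hessian_coercive[OF curv])
    show "\<forall>\<^sub>F k in sequentially. D (Suc k) = D k - (s k / m) *\<^sub>R (F (D k) + r k) - s k *\<^sub>R (?P *v n k)"
      using ev_K
    proof eventually_elim
      case (elim k)
      have PD: "?P *v D k = D k" unfolding D_def by (simp add: proj_ker_kernel mult_proj_ker)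
      have g: "gradf (Y k) = gradf xs + H *v D k + R k"
        using D_eq(1)[OF elim] by (simp add: R_def)
      have "D (Suc k) = ?P *v ((z k - xs) - s k *\<^sub>R ((1 / m) *\<^sub>R gradf (Y k) + e k + n k))"
        using elim by (simp add: D_eq(2) rec Y_def algebra_simps)
      also have "\<dots> = D k - s k *\<^sub>R ((1 / m) *\<^sub>R (?P *v (H *v D k) + ?P *v R k) + ?P *v e k + ?P *v n k)"
        unfolding matrix_vector_mult_diff_distrib[of ?P "z k - xs"] D_eq(2)[OF elim, symmetric]
        by (simp add: g P0 matrix_vector_right_distrib matrix_vector_mult_scaleR)
      also have "\<dots> = D k - (s k / m) *\<^sub>R (F (D k) + r k) - s k *\<^sub>R (?P *v n k)"
        using pos by (simp add: F_def r_def PD scaleR_add_right algebra_simps)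
      finally show ?case .
    qed
    show "\<forall>\<^sub>F k in sequentially. norm (r k) \<le> c0 * (norm (D k))\<^sup>2 + m * norm (e k)"
      using ev_K R
    proof eventually_elim
      case (elim k)
      have "norm (r k) \<le> norm (?P *v R k) + m * norm (?P *v e k)"
        unfolding r_def using pos by (intro order_trans[OF norm_triangle_ineq]) simp
      also have "\<dots> \<le> norm (R k) + m * norm (e k)"
        using pos by (intro add_mono mult_left_mono norm_proj_ker_le) auto
      also have "norm (R k) \<le> c0 * (norm (D k))\<^sup>2" using elim D_eq(1) by simp
      finally show ?case by simp
    qed
    have "(\<lambda>k. m * (norm (e k) / s k powr \<delta>)) \<longlonglongrightarrow> m * 0" by (intro tendsto_intros e)
    then show "(\<lambda>k. m * norm (e k) / s k powr \<delta>) \<longlonglongrightarrow> 0" by simp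
    show "D \<longlonglongrightarrow> 0"
      unfolding D_def using bounded_linear.tendsto[OF matrix_vector_mul_bounded_linear Y0, of ?P] by simp
    have "(\<lambda>k. s k / m) \<longlonglongrightarrow> 0 / m" using pos by (intro tendsto_intros s_lim) auto
    then show "(\<lambda>k. s k / m) \<longlonglongrightarrow> 0" by simp
    have "filterlim (\<lambda>n. 1 / m * (\<Sum>k<n. s k)) at_top sequentially"
      by (rule filterlim_tendsto_pos_mult_at_top[OF tendsto_const _ s_top]) (use pos in simp)
    then show "filterlim (\<lambda>n. \<Sum>k<n. s k / m) at_top sequentially"
      by (simp add: sum_divide_distrib)
    show "s (Suc k) powr \<delta> \<le> s k powr \<delta>" for k
      using pos range s0[of "Suc k"] unfolding s_def
      by (intro powr_mono2 divide_left_mono) (auto intro!: mult_pos_pos powr_mono2)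
    show "s k powr \<delta> / s (Suc k) powr \<delta> \<le> 1 + 1 / real (Suc k) / (s k / m) * (s k / m)" for k
      using step_powr_ratio_le[of a \<alpha> \<delta> k] pos range s0[of k] by (simp add: s_def)
    show "(\<lambda>k. 1 / real (Suc k) / (s k / m)) \<longlonglongrightarrow> 0"
      unfolding s_def using pos range by real_asymp
    have "summable (\<lambda>k. ?P *v ((s k / s (Suc k) powr \<delta>) *\<^sub>R n k))"
      by (rule bounded_linear.summable[OF matrix_vector_mul_bounded_linear n(2)])
    then show "summable (\<lambda>k. (s k *\<^sub>R (?P *v n k)) /\<^sub>R s (Suc k) powr \<delta>)"
      by (simp add: matrix_vector_mult_scaleR divide_inverse mult.commute)
  qed (use pos s0 less_imp_neq[OF s0] in \<open>auto simp: less_imp_le\<close>)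
  then show ?thesis by (simp add: D_def Y_def)
qed

section \<open>Consensus error\<close>

text \<open>Past the index where \<open>\<theta> k < p < 1\<close>, summing the recursion gives
  \<open>(1 - p) * S \<le> Q\<close> for the partial sums \<open>S\<close>; a series of nonnegative
  terms with bounded partial sums converges.\<close>

lemma summable_perturbed_contraction:
  fixes x y \<theta> :: "nat \<Rightarrow> real"
  assumes x: "\<And>k. 0 \<le> x k" and y: "\<And>k. 0 \<le> y k" "summable y"
    and \<theta>: "\<theta> \<longlonglongrightarrow> q" "q < 1"
    and rec: "\<And>k. x (Suc k) \<le> \<theta> k * x k + y k"
  shows "summable x"
proof -
  obtain p where p: "q < p" "p < 1" using dense[OF \<theta>(2)] by blast
  then obtain K where K: "\<And>k. k \<ge> K \<Longrightarrow> \<theta> k < p"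
    using order_tendstoD(2)[OF \<theta>(1) p(1)] unfolding eventually_sequentially by blast
  have le: "x (Suc k + K) \<le> p * x (k + K) + y (k + K)" for k
    using rec[of "k + K"] mult_right_mono[of "\<theta> (k + K)" p "x (k + K)"] K[of "k + K"] x[of "k + K"]
    by simp
  define Q where "Q = x K + (\<Sum>k. y (k + K))"
  have sy: "summable (\<lambda>k. y (k + K))" using y by (simp add: summable_iff_shift)
  have bound: "(\<Sum>k<n. x (k + K)) \<le> Q / (1 - p)" for n
  proof -
    define S where "S = (\<Sum>k<n. x (k + K))"
    have S0: "0 \<le> S" unfolding S_def using x by (intro sum_nonneg) auto
    have "S \<le> (\<Sum>k<Suc n. x (k + K))" unfolding S_def using x by simp
    also have "\<dots> = x K + (\<Sum>k<n. x (Suc k + K))" by (subst sum.lessThan_Suc_shift) simp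
    also have "\<dots> \<le> x K + (\<Sum>k<n. p * x (k + K) + y (k + K))"
      by (intro add_left_mono sum_mono le)
    also have "\<dots> = x K + p * S + (\<Sum>k<n. y (k + K))"
      by (simp add: sum.distrib sum_distrib_left S_def)
    also have "\<dots> \<le> p * S + Q"
      unfolding Q_def using sum_le_suminf[OF sy, of "{..<n}"] y by simp
    finally have "(1 - p) * S \<le> Q" by (simp add: algebra_simps)
    then show ?thesis using p by (simp add: S_def field_simps)
  qed
  have "summable (\<lambda>k. x (k + K))"
    using x bound by (intro summableI_nonneg_bounded) auto
  then show ?thesis by (simp add: summable_iff_shift)
qed

text \<open>The orthogonal projection of R^m onto the vectors with zero sum; applied to one
  coordinate of all agents it leaves their disagreement.\<close>

abbreviation (input) centering_matrix :: "real ^ 'm ^ 'm" where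
  "centering_matrix \<equiv> mat 1 - averaging_matrix"

lemma centering_matrix_mult:
  "(centering_matrix *v x) $ i = x $ i - (\<Sum>j\<in>UNIV. x $ j) / real CARD('m)"
  for x :: "real ^ 'm"
proof -
  have "(averaging_matrix *v x) $ i = (\<Sum>j\<in>UNIV. x $ j) / real CARD('m)"
    by (simp add: averaging_matrix_def matrix_vector_mult_def sum_divide_distrib)
  then show ?thesis by (simp add: matrix_vector_mult_diff_rdistrib)
qed

lemma inner_centering_matrix:
  "x \<bullet> (centering_matrix *v x) = (norm (centering_matrix *v x))\<^sup>2" for x :: "real ^ 'm"
proof -
  let ?\<mu> = "(\<Sum>j\<in>UNIV. x $ j) / real CARD('m)"
  have "(x - centering_matrix *v x) \<bullet> (centering_matrix *v x) = (\<Sum>i\<in>UNIV. ?\<mu> * (x $ i - ?\<mu>))"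
    by (simp add: inner_vec_def centering_matrix_mult)
  also have "\<dots> = ?\<mu> * ((\<Sum>i\<in>UNIV. x $ i) - real CARD('m) * ?\<mu>)"
    by (simp only: sum_distrib_left[symmetric] sum_subtractf sum_constant)
  also have "\<dots> = 0" by simp
  finally show ?thesis by (simp add: inner_diff_left power2_norm_eq_inner)
qed

lemma norm_centering_matrix_le: "norm (centering_matrix *v x) \<le> norm x" for x :: "real ^ 'm"
proof -
  have "norm (centering_matrix *v x) * norm (centering_matrix *v x) \<le> norm x * norm (centering_matrix *v x)"
    using norm_cauchy_schwarz[of x "centering_matrix *v x"]
    by (simp add: inner_centering_matrix power2_eq_square)
  then show ?thesis
    by (cases "norm (centering_matrix *v x) = 0") (auto dest: mult_right_le_imp_le)
qed

text \<open>Centring \<open>y\<close> subtracts a constant vector. The rows of \<open>W\<close> sum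
  to 1, so the constant passes through \<open>W\<close> unchanged and is removed by the outer
  centring. The recursion thus closes on the disagreement alone.\<close>

lemma centering_matrix_doubly_stochastic:
  fixes y :: "real ^ 'm"
  assumes "doubly_stochastic W"
  shows "centering_matrix *v (W *v (centering_matrix *v y)) = centering_matrix *v (W *v y)"
proof -
  let ?\<mu> = "(\<Sum>j\<in>UNIV. y $ j) / real CARD('m)"
  have "(W *v (centering_matrix *v y)) $ i = (W *v y) $ i - ?\<mu>" for i
  proof -
    have "(W *v (centering_matrix *v y)) $ i = (\<Sum>j\<in>UNIV. W $ i $ j * (y $ j - ?\<mu>))"
      by (subst matrix_vector_mult_def) (simp add: centering_matrix_mult)
    also have "\<dots> = (W *v y) $ i - (\<Sum>j\<in>UNIV. W $ i $ j) * ?\<mu>"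
      by (simp only: right_diff_distrib sum_subtractf sum_distrib_right) (simp add: matrix_vector_mult_def)
    also have "(\<Sum>j\<in>UNIV. W $ i $ j) = 1" using assms by (simp add: doubly_stochastic_def)
    finally show ?thesis by simp
  qed
  then show ?thesis
    by (simp add: vec_eq_iff centering_matrix_mult sum_subtractf diff_divide_distrib)
qed

text \<open>Each row has Euclidean norm at most its entry sum 1. The bound keeps the random matrices
  in a fixed ball, on which the matrix product to be averaged is bounded and hence
  integrable.\<close>

lemma norm_doubly_stochastic_le:
  fixes W :: "real ^ 'm ^ 'm"
  assumes "doubly_stochastic W" shows "norm W \<le> real CARD('m)"
proof -
  have "norm W \<le> (\<Sum>i\<in>UNIV. norm (W $ i))"
    unfolding norm_vec_def by (rule L2_set_le_sum) simp
  also have "\<dots> \<le> (\<Sum>i\<in>(UNIV::'m set). 1)"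
  proof (rule sum_mono)
    fix i
    have "norm (W $ i) \<le> (\<Sum>j\<in>UNIV. \<bar>W $ i $ j\<bar>)" by (rule norm_le_l1_cart)
    also have "\<dots> = 1" using assms by (simp add: doubly_stochastic_def)
    finally show "norm (W $ i) \<le> 1" .
  qed
  finally show ?thesis by simp
qed

lemma continuous_on_matrix_vector_mult:
  fixes f :: "'a::topological_space \<Rightarrow> real ^ 'n ^ 'm"
  assumes "continuous_on S f" "continuous_on S g"
  shows "continuous_on S (\<lambda>x. f x *v g x)"
  unfolding matrix_vector_mult_def using assms by (intro continuous_intros)

text \<open>The squared norm is a quadratic form in \<open>u\<close> that is linear in the matrix
  \<open>Z W\<close>, so the expectation moves onto the matrix, and the spectral norm of the mean
  matrix bounds the form. A single weight matrix need not contract; the mean square does when that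
  norm is below 1.\<close>

lemma (in prob_space) mixing_contraction:
  fixes A :: "'a \<Rightarrow> real ^ 'm ^ 'm"
  assumes A[measurable]: "A \<in> borel_measurable M" and ds: "AE w in M. doubly_stochastic (A w)"
  shows "(\<integral>\<^sup>+ w. ennreal ((norm (centering_matrix *v (A w *v u)))\<^sup>2) \<partial>M) \<le>
    ennreal (spectral_norm (LINT w|M. transpose (A w) ** centering_matrix ** A w) * (norm u)\<^sup>2)"
proof -
  define Z :: "real ^ 'm ^ 'm \<Rightarrow> real ^ 'm ^ 'm" where "Z W = transpose W ** centering_matrix ** W" for W
  have Zc: "continuous_on UNIV Z"
    unfolding Z_def matrix_matrix_mult_def transpose_def by (intro continuous_intros)
  have [measurable]: "Z \<in> borel_measurable borel" using Zc by (rule borel_measurable_continuous_onI)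
  have "compact (Z ` cball 0 (real CARD('m)))"
    by (rule compact_continuous_image[OF continuous_on_subset[OF Zc subset_UNIV] compact_cball])
  then obtain b where b: "\<And>W. W \<in> cball 0 (real CARD('m)) \<Longrightarrow> norm (Z W) \<le> b"
    by (meson bounded_iff compact_imp_bounded imageI)
  have int: "integrable M (\<lambda>w. Z (A w))"
  proof (rule integrable_const_bound)
    show "AE w in M. norm (Z (A w)) \<le> b"
      using ds by eventually_elim (auto intro!: b norm_doubly_stochastic_le)
  qed simp
  have lin: "bounded_linear (\<lambda>W. u \<bullet> (W *v u))"
    unfolding linear_conv_bounded_linear[symmetric] by (rule linearI)
       (auto simp: matrix_vector_mult_add_rdistrib inner_add_right scaleR_matrix_vector_assoc[symmetric])
  have sq: "(norm (centering_matrix *v (W *v u)))\<^sup>2 = u \<bullet> (Z W *v u)" for W :: "real ^ 'm ^ 'm"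
  proof -
    have "(norm (centering_matrix *v (W *v u)))\<^sup>2 = (centering_matrix *v (W *v u)) \<bullet> (W *v u)"
      by (simp only: inner_centering_matrix[symmetric] inner_commute)
    also have "\<dots> = (transpose W *v (centering_matrix *v (W *v u))) \<bullet> u"
      by (simp only: inner_transpose_mult)
    finally show ?thesis by (simp only: Z_def matrix_vector_mul_assoc matrix_mul_assoc inner_commute)
  qed
  have "(\<integral>\<^sup>+ w. ennreal (u \<bullet> (Z (A w) *v u)) \<partial>M) = ennreal (LINT w|M. u \<bullet> (Z (A w) *v u))"
    by (rule nn_integral_eq_integral[OF integrable_bounded_linear[OF lin int]])
       (simp only: sq[symmetric] zero_le_power2 AE_I2)
  also have "(LINT w|M. u \<bullet> (Z (A w) *v u)) = u \<bullet> ((LINT w|M. Z (A w)) *v u)"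
    by (rule integral_bounded_linear[OF lin int])
  also have "\<dots> \<le> norm u * norm ((LINT w|M. Z (A w)) *v u)" by (rule norm_cauchy_schwarz)
  also have "\<dots> \<le> norm u * (spectral_norm (LINT w|M. Z (A w)) * norm u)"
    unfolding spectral_norm_def by (intro mult_left_mono onorm matrix_vector_mul_bounded_linear) auto
  finally show ?thesis unfolding sq Z_def[symmetric] by (simp add: power2_eq_square mult_ac ennreal_leI)
qed

text \<open>The second moments obey a contraction with an inhomogeneity of order (s k)^2. The
  weights grow by factors whose bounds tend to 1, so they leave the contraction intact. The weighted
  second moments are therefore summable, and finiteness of the expected series forces its terms to 0
  almost surely.\<close>

lemma (in prob_space) consensus_error_L2:
  fixes A :: "nat \<Rightarrow> 'a \<Rightarrow> real ^ 'm ^ 'm" and u g :: "nat \<Rightarrow> 'a \<Rightarrow> real ^ 'm"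
  assumes G: "\<And>k. subalgebra M (G k)" and u: "\<And>k. u k \<in> borel_measurable (G k)"
    and g[measurable]: "\<And>k. g k \<in> borel_measurable M"
    and A[measurable]: "\<And>k. A k \<in> borel_measurable M"
    and fresh: "\<And>k. indep_of_algebra M borel (A k) (G k)"
    and ds: "\<And>k. AE w in M. doubly_stochastic (A k w)"
    and \<rho>: "\<And>k. spectral_norm (LINT w|M. transpose (A k w) ** centering_matrix ** A k w) \<le> \<rho>" "\<rho> < 1"
    and rec: "\<And>k. AE w in M. u (Suc k) w = centering_matrix *v (A k w *v u k w) - s k *\<^sub>R (centering_matrix *v g k w)"
    and g2: "\<And>k. (\<integral>\<^sup>+ w. ennreal ((norm (g k w))\<^sup>2) \<partial>M) \<le> ennreal \<gamma>"
    and u0: "\<And>w. norm (u 0 w) \<le> R"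
    and W: "\<And>k. 0 < W k" "\<And>k. W (Suc k) \<le> \<theta> k * W k" "\<theta> \<longlonglongrightarrow> 1"
    and summ: "summable (\<lambda>k. W (Suc k) * (s k)\<^sup>2)"
  shows "AE w in M. (\<lambda>k. W k * (norm (u k w))\<^sup>2) \<longlonglongrightarrow> 0"
proof -
  note [measurable] = measurable_from_subalg[OF G u]
  define \<rho>' where "\<rho>' = max \<rho> 0"
  have \<rho>': "0 \<le> \<rho>'" "\<rho>' < 1" "\<rho> \<le> \<rho>'" using \<rho>(2) by (auto simp: \<rho>'_def)
  \<comment> \<open>With this choice 1 - q = (1 - \<rho>') (2 - \<rho>') / 2 > 0, so the loss in
    Young's inequality still leaves a contraction.\<close>
  define \<eta> where "\<eta> = (1 - \<rho>') / 2"
  define q where "q = (1 + \<eta>) * \<rho>'"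
  have \<eta>: "0 < \<eta>" using \<rho>' by (simp add: \<eta>_def)
  have q: "0 \<le> q" "q < 1"
  proof -
    show "0 \<le> q" using \<eta> \<rho>' by (simp add: q_def)
    have "0 < (1 - \<rho>') * (2 - \<rho>')" using \<rho>' by (intro mult_pos_pos) auto
    then show "q < 1" by (simp add: q_def \<eta>_def field_simps)
  qed
  define \<gamma>' where "\<gamma>' = (1 + 1 / \<eta>) * max \<gamma> 0"
  have \<gamma>': "0 \<le> \<gamma>'" using \<eta> by (simp add: \<gamma>'_def)
  have g2': "(\<integral>\<^sup>+ w. ennreal ((norm (g k w))\<^sup>2) \<partial>M) \<le> ennreal (max \<gamma> 0)" for k
    by (rule order_trans[OF g2[of k]]) (simp add: ennreal_leI)
  define N where "N k = (\<integral>\<^sup>+ w. ennreal ((norm (u k w))\<^sup>2) \<partial>M)" for k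
  \<comment> \<open>\<open>A k\<close> and \<open>g k\<close> belong to the same step and may be
    dependent, so the cross term cannot be expected to vanish; it is split with weight
    \<open>\<eta>\<close> instead.\<close>
  have young: "(norm (x - h *\<^sub>R y))\<^sup>2 \<le> (1 + \<eta>) * (norm x)\<^sup>2 + (1 + 1 / \<eta>) * (h\<^sup>2 * (norm y)\<^sup>2)"
    for x y :: "real ^ 'm" and h
  proof -
    have "(norm (x - h *\<^sub>R y))\<^sup>2 \<le> (norm x + \<bar>h\<bar> * norm y)\<^sup>2"
      using norm_triangle_ineq4[of x "h *\<^sub>R y"] by (intro power_mono) auto
    also have "\<dots> = (norm x)\<^sup>2 + 2 * norm x * (\<bar>h\<bar> * norm y) + h\<^sup>2 * (norm y)\<^sup>2"
      by (simp add: power2_sum power_mult_distrib)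
    also have "2 * norm x * (\<bar>h\<bar> * norm y) \<le> \<eta> * (norm x)\<^sup>2 + 1 / \<eta> * (h\<^sup>2 * (norm y)\<^sup>2)"
    proof -
      have "0 \<le> (\<eta> * norm x - \<bar>h\<bar> * norm y)\<^sup>2 / \<eta>" using \<eta> by simp
      also have "\<dots> = \<eta> * (norm x)\<^sup>2 + 1 / \<eta> * (h\<^sup>2 * (norm y)\<^sup>2) - 2 * norm x * (\<bar>h\<bar> * norm y)"
        using \<eta> by (simp add: power2_diff power_mult_distrib field_simps power2_eq_square)
      finally show ?thesis by simp
    qed
    finally show ?thesis by (simp add: algebra_simps)
  qed
  have stepN: "N (Suc k) \<le> ennreal q * N k + ennreal (\<gamma>' * (s k)\<^sup>2)" for k
  proof -
    let ?x = "\<lambda>w. centering_matrix *v (A k w *v u k w)"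
    have meas[measurable]: "(\<lambda>p. centering_matrix *v (snd p *v fst p))
        \<in> borel_measurable (borel \<Otimes>\<^sub>M (borel :: (real ^ 'm ^ 'm) measure))"
      unfolding borel_prod
      by (intro borel_measurable_continuous_onI continuous_intros continuous_on_matrix_vector_mult
          continuous_on_const)
    have [measurable]: "?x \<in> borel_measurable M"
      using measurable_compose[OF _ meas, of "\<lambda>w. (u k w, A k w)" M] by simp
    have "N (Suc k) \<le> (\<integral>\<^sup>+ w. ennreal (1 + \<eta>) * ennreal ((norm (?x w))\<^sup>2)
        + ennreal ((1 + 1 / \<eta>) * (s k)\<^sup>2) * ennreal ((norm (g k w))\<^sup>2) \<partial>M)"
      unfolding N_def
    proof (rule nn_integral_mono_AE)
      show "AE w in M. ennreal ((norm (u (Suc k) w))\<^sup>2) \<le> ennreal (1 + \<eta>) * ennreal ((norm (?x w))\<^sup>2)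
        + ennreal ((1 + 1 / \<eta>) * (s k)\<^sup>2) * ennreal ((norm (g k w))\<^sup>2)"
        using rec[of k]
      proof eventually_elim
        case (elim w)
        have "(norm (u (Suc k) w))\<^sup>2 \<le> (1 + \<eta>) * (norm (?x w))\<^sup>2
            + (1 + 1 / \<eta>) * ((s k)\<^sup>2 * (norm (centering_matrix *v g k w))\<^sup>2)"
          unfolding elim by (rule young)
        also have "\<dots> \<le> (1 + \<eta>) * (norm (?x w))\<^sup>2 + (1 + 1 / \<eta>) * ((s k)\<^sup>2 * (norm (g k w))\<^sup>2)"
          using \<eta> by (intro add_left_mono mult_left_mono power_mono norm_centering_matrix_le) auto
        finally show ?case using \<eta>
          by (simp add: ennreal_plus[symmetric] ennreal_mult[symmetric] mult.assoc del: ennreal_plus)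
      qed
    qed
    also have "\<dots> = ennreal (1 + \<eta>) * (\<integral>\<^sup>+ w. ennreal ((norm (?x w))\<^sup>2) \<partial>M)
        + ennreal ((1 + 1 / \<eta>) * (s k)\<^sup>2) * (\<integral>\<^sup>+ w. ennreal ((norm (g k w))\<^sup>2) \<partial>M)"
      by (simp add: nn_integral_add nn_integral_cmult)
    also have "\<dots> \<le> ennreal (1 + \<eta>) * (\<integral>\<^sup>+ w. ennreal (\<rho>' * (norm (u k w))\<^sup>2) \<partial>M)
        + ennreal ((1 + 1 / \<eta>) * (s k)\<^sup>2) * ennreal (max \<gamma> 0)"
    proof (intro add_mono mult_left_mono g2')
      show "(\<integral>\<^sup>+ w. ennreal ((norm (?x w))\<^sup>2) \<partial>M) \<le> (\<integral>\<^sup>+ w. ennreal (\<rho>' * (norm (u k w))\<^sup>2) \<partial>M)"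
      \<comment> \<open>\<open>u k\<close> is determined by the past and \<open>A k\<close> is
        fresh, so the mixing bound for fixed vectors may be averaged over
        \<open>u k\<close>.\<close>
      proof (rule nn_integral_fresh_le[OF fresh A G u])
        show "(\<lambda>(v, W :: real ^ 'm ^ 'm). ennreal ((norm (centering_matrix *v (W *v v)))\<^sup>2)) \<in> borel_measurable (borel \<Otimes>\<^sub>M borel)"
          using measurable_compose[OF meas, of "\<lambda>x. ennreal ((norm x)\<^sup>2)" borel]
          by (simp add: case_prod_beta')
        fix v :: "real ^ 'm"
        have "(\<integral>\<^sup>+ w. ennreal ((norm (centering_matrix *v (A k w *v v)))\<^sup>2) \<partial>M) \<le>
          ennreal (spectral_norm (LINT w|M. transpose (A k w) ** centering_matrix ** A k w) * (norm v)\<^sup>2)"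
          by (rule mixing_contraction[OF A ds])
        also have "\<dots> \<le> ennreal (\<rho>' * (norm v)\<^sup>2)"
          using \<rho>(1)[of k] \<rho>'(3) by (intro ennreal_leI mult_right_mono) auto
        finally show "(\<integral>\<^sup>+ w. ennreal ((norm (centering_matrix *v (A k w *v v)))\<^sup>2) \<partial>M) \<le> ennreal (\<rho>' * (norm v)\<^sup>2)" .
      qed simp
    qed auto
    also have "(\<integral>\<^sup>+ w. ennreal (\<rho>' * (norm (u k w))\<^sup>2) \<partial>M) = ennreal \<rho>' * N k"
      using \<rho>' by (simp add: N_def ennreal_mult nn_integral_cmult)
    also have "ennreal (1 + \<eta>) * (ennreal \<rho>' * N k) = ennreal q * N k"
      using \<eta> \<rho>' by (simp only: q_def ennreal_mult[of "1 + \<eta>" \<rho>'] mult.assoc)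
    also have "ennreal ((1 + 1 / \<eta>) * (s k)\<^sup>2) * ennreal (max \<gamma> 0) = ennreal (\<gamma>' * (s k)\<^sup>2)"
      using \<eta> by (subst ennreal_mult[symmetric]) (simp_all add: \<gamma>'_def mult_ac)
    finally show ?thesis .
  qed
  \<comment> \<open>A real majorant of the extended second moments \<open>N\<close>, started at the
    bound on the initial disagreement; the induction along it also shows that \<open>N\<close> is
    finite.\<close>
  define b where "b = rec_nat (R\<^sup>2) (\<lambda>k v. q * v + \<gamma>' * (s k)\<^sup>2)"
  have bS: "b (Suc k) = q * b k + \<gamma>' * (s k)\<^sup>2" for k by (simp add: b_def)
  have b0: "0 \<le> b k" for k by (induction k) (use q \<gamma>' in \<open>auto simp: b_def\<close>)
  have Nb: "N k \<le> ennreal (b k)" for k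
  proof (induction k)
    case 0
    have "N 0 \<le> (\<integral>\<^sup>+ w. ennreal (R\<^sup>2) \<partial>M)"
      unfolding N_def using u0 by (intro nn_integral_mono ennreal_leI power_mono) auto
    then show ?case by (simp add: b_def emeasure_space_1)
  next
    case (Suc k)
    have "N (Suc k) \<le> ennreal q * ennreal (b k) + ennreal (\<gamma>' * (s k)\<^sup>2)"
      by (rule order_trans[OF stepN]) (intro add_right_mono mult_left_mono Suc, simp)
    also have "\<dots> = ennreal (b (Suc k))"
      using q b0 \<gamma>' by (simp add: bS ennreal_mult)
    finally show ?case .
  qed
  have "summable (\<lambda>k. W k * b k)"
  proof (rule summable_perturbed_contraction[where \<theta> = "\<lambda>k. \<theta> k * q" and y = "\<lambda>k. \<gamma>' * (W (Suc k) * (s k)\<^sup>2)"])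
    show "(\<lambda>k. \<theta> k * q) \<longlonglongrightarrow> q" using tendsto_mult[OF W(3) tendsto_const, of q] by simp
    show "summable (\<lambda>k. \<gamma>' * (W (Suc k) * (s k)\<^sup>2))" using summ by (rule summable_mult)
    show "W (Suc k) * b (Suc k) \<le> \<theta> k * q * (W k * b k) + \<gamma>' * (W (Suc k) * (s k)\<^sup>2)" for k
    proof -
      have "W (Suc k) * (q * b k) \<le> (\<theta> k * W k) * (q * b k)"
        using W(2) q b0 by (intro mult_right_mono) auto
      then show ?thesis by (simp add: bS algebra_simps)
    qed
  qed (use W(1) b0 q \<gamma>' in \<open>auto simp: less_imp_le\<close>)
  then have fin: "(\<Sum>k. ennreal (W k * b k)) < \<infinity>"
    using W(1) b0 by (subst suminf_ennreal2) (auto simp: less_imp_le)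
  have "(\<integral>\<^sup>+ w. (\<Sum>k. ennreal (W k * (norm (u k w))\<^sup>2)) \<partial>M) = (\<Sum>k. ennreal (W k) * N k)"
    unfolding N_def using W(1)
    by (subst nn_integral_suminf) (auto simp: ennreal_mult less_imp_le nn_integral_cmult)
  also have "\<dots> \<le> (\<Sum>k. ennreal (W k * b k))"
    using W(1) b0 Nb by (intro suminf_le) (auto simp: ennreal_mult less_imp_le intro!: mult_left_mono)
  finally have "(\<integral>\<^sup>+ w. (\<Sum>k. ennreal (W k * (norm (u k w))\<^sup>2)) \<partial>M) \<noteq> \<infinity>"
    using fin by auto
  then have "AE w in M. (\<Sum>k. ennreal (W k * (norm (u k w))\<^sup>2)) \<noteq> \<infinity>"
    by (rule nn_integral_noteq_infinite[rotated]) simp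
  then show ?thesis
  proof eventually_elim
    case (elim w)
    then have "summable (\<lambda>k. W k * (norm (u k w))\<^sup>2)"
      using W(1) by (intro summable_suminf_not_top) (auto simp: less_imp_le)
    then show ?case by (rule summable_LIMSEQ_zero)
  qed
qed

text \<open>The initial points need not be square integrable, hence the localization to the events on which
  the initial disagreement is bounded.\<close>

lemma (in prob_space) consensus_error:
  fixes A :: "nat \<Rightarrow> 'a \<Rightarrow> real ^ 'm ^ 'm" and u g :: "nat \<Rightarrow> 'a \<Rightarrow> real ^ 'm"
  assumes G: "\<And>k. subalgebra M (G k)" "\<And>k. sets (G k) \<subseteq> sets (G (Suc k))"
    and u: "\<And>k. u k \<in> borel_measurable (G k)"
    and g[measurable]: "\<And>k. g k \<in> borel_measurable M"
    and A: "\<And>k. A k \<in> borel_measurable M"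
    and fresh: "\<And>k. indep_of_algebra M borel (A k) (G k)"
    and ds: "\<And>k. AE w in M. doubly_stochastic (A k w)"
    and \<rho>: "\<And>k. spectral_norm (LINT w|M. transpose (A k w) ** centering_matrix ** A k w) \<le> \<rho>" "\<rho> < 1"
    and rec: "\<And>k. AE w in M. u (Suc k) w = centering_matrix *v (A k w *v u k w) - s k *\<^sub>R (centering_matrix *v g k w)"
    and g2: "\<And>k. (\<integral>\<^sup>+ w. ennreal ((norm (g k w))\<^sup>2) \<partial>M) \<le> ennreal \<gamma>"
    and W: "\<And>k. 0 < W k" "\<And>k. W (Suc k) \<le> \<theta> k * W k" "\<theta> \<longlonglongrightarrow> 1"
    and summ: "summable (\<lambda>k. W (Suc k) * (s k)\<^sup>2)"
  shows "AE w in M. (\<lambda>k. W k * (norm (u k w))\<^sup>2) \<longlonglongrightarrow> 0"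
proof -
  \<comment> \<open>The indicator is known at time 0, so multiplying \<open>u\<close> and
    \<open>g\<close> by it keeps the measurability and the linear recursion while bounding the
    initial value by \<open>R\<close>.\<close>
  define i where "i R w = (if norm (u 0 w) \<le> real R then 1 else 0 :: real)" for R :: nat and w
  have sub: "subalgebra (G k) (G 0)" for k
    using lift_Suc_mono_le[of "\<lambda>k. sets (G k)" 0 k] G by (auto simp: subalgebra_def)
  have i[measurable]: "i R \<in> borel_measurable (G k)" for R k
  proof (rule measurable_from_subalg[OF sub])
    show "i R \<in> borel_measurable (G 0)" unfolding i_def using u[of 0] by measurable
  qed
  have "AE w in M. (\<lambda>k. W k * (norm (i R w *\<^sub>R u k w))\<^sup>2) \<longlonglongrightarrow> 0" for R
  proof (rule consensus_error_L2[where g = "\<lambda>k w. i R w *\<^sub>R g k w" and G = G and A = A and R = "real R"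
        and \<gamma> = \<gamma>, OF G(1) _ _ A fresh ds \<rho> _ _ _ W summ])
    show "(\<lambda>w. i R w *\<^sub>R u k w) \<in> borel_measurable (G k)" for k using i u by simp
    show "(\<lambda>w. i R w *\<^sub>R g k w) \<in> borel_measurable M" for k
      using measurable_from_subalg[OF G(1) i] g by simp
    show "norm (i R w *\<^sub>R u 0 w) \<le> real R" for w by (simp add: i_def)
    show "AE w in M. i R w *\<^sub>R u (Suc k) w = centering_matrix *v (A k w *v (i R w *\<^sub>R u k w))
        - s k *\<^sub>R (centering_matrix *v (i R w *\<^sub>R g k w))" for k
      using rec[of k] by eventually_elim (simp add: matrix_vector_mult_scaleR scaleR_diff_right)
    show "(\<integral>\<^sup>+ w. ennreal ((norm (i R w *\<^sub>R g k w))\<^sup>2) \<partial>M) \<le> ennreal \<gamma>" for k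
      by (rule order_trans[OF nn_integral_mono g2[of k]]) (simp add: i_def)
  qed
  then have "AE w in M. \<forall>R. (\<lambda>k. W k * (norm (i R w *\<^sub>R u k w))\<^sup>2) \<longlonglongrightarrow> 0"
    by (simp add: AE_all_countable)
  then show ?thesis
  proof eventually_elim
    case (elim w)
    obtain R :: nat where "norm (u 0 w) \<le> real R" using real_arch_simple by blast
    then have "i R w = 1" by (simp add: i_def)
    then show ?case using spec[OF elim, of R] by simp
  qed
qed

section \<open>Histories and gradient noise\<close>

lemma borel_measurable_vec_component [measurable (raw)]:
  fixes f :: "'a \<Rightarrow> ('b::topological_space) ^ 'n"
  shows "f \<in> borel_measurable M \<Longrightarrow> (\<lambda>x. f x $ i) \<in> borel_measurable M"
  by (erule measurable_compose) (intro borel_measurable_continuous_onI continuous_intros)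

lemma borel_measurable_vec_lambda:
  fixes f :: "'a \<Rightarrow> 'n::finite \<Rightarrow> real"
  assumes "\<And>i. (\<lambda>x. f x i) \<in> borel_measurable M"
  shows "(\<lambda>x. \<chi> i. f x i) \<in> borel_measurable M"
  using assms by (subst borel_measurable_euclidean_space) (auto simp: Basis_vec_def inner_axis)

lemma measurable_of_vimage_algebra:
  assumes "f \<in> space M \<rightarrow> space N" "space H = space M"
    "sets (vimage_algebra (space M) f N) \<subseteq> sets H"
  shows "f \<in> measurable H N"
  using assms by (intro measurableI) (auto intro: in_vimage_algebra)

lemma sets_vimage_algebra_subset:
  "f \<in> measurable M N \<Longrightarrow> sets (vimage_algebra (space M) f N) \<subseteq> sets M"
  by (subst sets_vimage_algebra2) (auto dest: measurable_space)

lemma sets_vimage_algebra_subset_Pow: "sets (vimage_algebra X f N) \<subseteq> Pow X"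
  using sets.space_closed[of "vimage_algebra X f N"] by simp

context
  fixes M :: "'w measure" and S :: "'m::finite \<Rightarrow> 's measure"
    and z0 :: "'m \<Rightarrow> 'w \<Rightarrow> real ^ 'd" and \<xi> :: "'m \<Rightarrow> nat \<Rightarrow> 'w \<Rightarrow> 's"
    and A :: "nat \<Rightarrow> 'w \<Rightarrow> real ^ 'm ^ 'm"
begin

lemma space_history: "space (history M S z0 \<xi> A k) = space M"
  unfolding history_def
  by (intro space_measure_of Un_least UN_least sets_vimage_algebra_subset_Pow)

lemma sets_history: "sets (history M S z0 \<xi> A k) = sigma_sets (space M)
    ((\<Union>j. sets (vimage_algebra (space M) (z0 j) borel)) \<union>
     (\<Union>j. \<Union>t\<in>{1..k-1}. sets (vimage_algebra (space M) (\<xi> j t) (S j))) \<union>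
     (\<Union>t\<in>{1..k-1}. sets (vimage_algebra (space M) (A t) borel)))"
  unfolding history_def
  by (intro sets_measure_of Un_least UN_least sets_vimage_algebra_subset_Pow)

lemma history_mono: "k \<le> l \<Longrightarrow> sets (history M S z0 \<xi> A k) \<subseteq> sets (history M S z0 \<xi> A l)"
  unfolding sets_history by (rule sigma_sets_mono') force

lemma subalgebra_history:
  assumes "\<And>j. z0 j \<in> borel_measurable M" "\<And>j t. 1 \<le> t \<Longrightarrow> \<xi> j t \<in> measurable M (S j)"
    "\<And>t. 1 \<le> t \<Longrightarrow> A t \<in> borel_measurable M"
  shows "subalgebra M (history M S z0 \<xi> A k)"
proof -
  have "sets (history M S z0 \<xi> A k) \<subseteq> sets M"
    unfolding sets_history using assms
    by (intro sets.sigma_sets_subset Un_least UN_least sets_vimage_algebra_subset) auto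
  then show ?thesis by (simp add: subalgebra_def space_history)
qed

lemma measurable_history_initial: "z0 j \<in> borel_measurable (history M S z0 \<xi> A k)"
  by (rule measurable_of_vimage_algebra[OF _ space_history])
     (auto simp: sets_history intro!: sigma_sets.Basic)

lemma measurable_history_sample:
  assumes "\<xi> j t \<in> measurable M (S j)" "1 \<le> t" "t < k"
  shows "\<xi> j t \<in> measurable (history M S z0 \<xi> A k) (S j)"
  using assms
  by (intro measurable_of_vimage_algebra[OF _ space_history])
     (force simp: sets_history dest: measurable_space intro!: sigma_sets.Basic)+

lemma measurable_history_weights:
  assumes "1 \<le> t" "t < k"
  shows "A t \<in> borel_measurable (history M S z0 \<xi> A k)"
  using assms
  by (intro measurable_of_vimage_algebra[OF _ space_history])
     (force simp: sets_history intro!: sigma_sets.Basic)+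

end

text \<open>Each coordinate of the weighted noise is a martingale difference: \<open>y k\<close> is
  known at time \<open>k\<close> and \<open>\<xi> k\<close> is fresh. All samples have the law of
  \<open>\<xi>\<^sub>0\<close>, so the second moment is at most (c k)^2 times the constant
  \<open>\<kappa>\<close>. Leaving the weights \<open>c\<close> free lets plain and rescaled noise
  be treated alike.\<close>

lemma (in prob_space) fresh_sample_noise_summable:
  fixes g :: "real ^ 'd \<Rightarrow> 's \<Rightarrow> real ^ 'd" and y :: "nat \<Rightarrow> 'a \<Rightarrow> real ^ 'd"
  assumes G: "\<And>k. subalgebra M (G k)" "\<And>k. sets (G k) \<subseteq> sets (G (Suc k))"
    and \<xi>\<^sub>0[measurable]: "\<xi>\<^sub>0 \<in> measurable M S"
    and g[measurable]: "(\<lambda>(u, s). g u s) \<in> borel_measurable (restrict_space borel X \<Otimes>\<^sub>M S)"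
    and mean: "\<And>u. u \<in> X \<Longrightarrow> \<phi> u = (LINT w|M. g u (\<xi>\<^sub>0 w))"
    and bound: "\<And>u s. u \<in> X \<Longrightarrow> s \<in> space S \<Longrightarrow> norm (g u s) \<le> l s"
    and l[measurable]: "l \<in> borel_measurable S"
    and l2: "integrable M (\<lambda>w. (l (\<xi>\<^sub>0 w))\<^sup>2)"
    and y: "\<And>k. y k \<in> measurable (G k) (restrict_space borel X)"
    and \<xi>: "\<And>k. \<xi> k \<in> measurable (G (Suc k)) S"
    and fresh: "\<And>k. indep_of_algebra M S (\<xi> k) (G k)"
    and ident: "\<And>k. distr M S (\<xi> k) = distr M S \<xi>\<^sub>0"
    and c: "summable (\<lambda>k. (c k)\<^sup>2)"
  shows "AE w in M. summable (\<lambda>k. c k *\<^sub>R (g (y k w) (\<xi> k w) - \<phi> (y k w)))"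
proof -
  let ?K = "restrict_space borel X :: (real ^ 'd) measure"
  have sub: "subalgebra (G (Suc k)) (G k)" for k using G by (auto simp: subalgebra_def)
  have \<xi>M[measurable]: "\<xi> k \<in> measurable M S" for k by (rule measurable_from_subalg[OF G(1) \<xi>])
  have yM[measurable]: "y k \<in> measurable M ?K" for k by (rule measurable_from_subalg[OF G(1) y])
  have yX: "y k w \<in> X" if "w \<in> space M" for k w
    using measurable_space[OF yM that] by (simp add: space_restrict_space)
  have \<xi>S: "\<xi> k w \<in> space S" "\<xi>\<^sub>0 w \<in> space S" if "w \<in> space M" for k w
    using that measurable_space[OF \<xi>M] measurable_space[OF \<xi>\<^sub>0] by auto
  have g_sec[measurable]: "g u \<in> borel_measurable S" if "u \<in> X" for u
    using measurable_Pair2[OF g, of u] that by (simp add: space_restrict_space)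
  have \<phi>[measurable]: "\<phi> \<in> borel_measurable ?K"
  proof -
    have "(\<lambda>p. g (fst p) (\<xi>\<^sub>0 (snd p))) \<in> borel_measurable (?K \<Otimes>\<^sub>M M)"
      using measurable_compose[OF _ g, of "\<lambda>p. (fst p, \<xi>\<^sub>0 (snd p))"] by simp
    then have "(\<lambda>u. LINT w|M. g u (\<xi>\<^sub>0 w)) \<in> borel_measurable ?K"
      by (intro borel_measurable_lebesgue_integral) (simp add: case_prod_beta')
    then show ?thesis
      by (rule measurable_cong[THEN iffD1, rotated]) (simp add: mean space_restrict_space)
  qed
  have l1: "integrable M (\<lambda>w. l (\<xi>\<^sub>0 w))"
    by (rule square_integrable_imp_integrable[OF _ l2]) measurable
  have g_int: "integrable M (\<lambda>w. g u (\<xi>\<^sub>0 w))" if u: "u \<in> X" for u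
  proof (rule Bochner_Integration.integrable_bound[OF l1])
    show "(\<lambda>w. g u (\<xi>\<^sub>0 w)) \<in> borel_measurable M" using g_sec[OF u] by measurable
    show "AE w in M. norm (g u (\<xi>\<^sub>0 w)) \<le> norm (l (\<xi>\<^sub>0 w))"
      using bound[OF u \<xi>S(2)] by (intro AE_I2) (force intro: order_trans)
  qed
  \<comment> \<open>The mean gradient inherits a uniform bound over \<open>X\<close>, so
    \<open>l + b\<close> dominates the noise wherever the iterate is.\<close>
  define b where "b = expectation (\<lambda>w. l (\<xi>\<^sub>0 w))"
  have \<phi>_bound: "norm (\<phi> u) \<le> b" if u: "u \<in> X" for u
    unfolding mean[OF u] b_def
    using integral_mono[OF integrable_norm[OF g_int[OF u]] l1 bound[OF u \<xi>S(2)]]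
    by (rule order_trans[OF integral_norm_bound])
  have int_lb: "integrable M (\<lambda>w. (l (\<xi>\<^sub>0 w) + b)\<^sup>2)"
    using l1 l2 by (simp add: power2_sum)
  define \<kappa> where "\<kappa> = expectation (\<lambda>w. (l (\<xi>\<^sub>0 w) + b)\<^sup>2)"
  have int_lbk: "integrable M (\<lambda>w. (l (\<xi> k w) + b)\<^sup>2)"
    and \<kappa>: "expectation (\<lambda>w. (l (\<xi> k w) + b)\<^sup>2) = \<kappa>" for k
  proof -
    have "integrable (distr M S \<xi>\<^sub>0) (\<lambda>s. (l s + b)\<^sup>2)"
      using int_lb by (subst integrable_distr_eq) auto
    then show "integrable M (\<lambda>w. (l (\<xi> k w) + b)\<^sup>2)"
      unfolding ident[of k, symmetric] by (subst (asm) integrable_distr_eq) auto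
    have "expectation (\<lambda>w. (l (\<xi> k w) + b)\<^sup>2) = (LINT s|distr M S (\<xi> k). (l s + b)\<^sup>2)"
      by (subst integral_distr) auto
    also have "\<dots> = \<kappa>" unfolding ident \<kappa>_def by (subst integral_distr) auto
    finally show "expectation (\<lambda>w. (l (\<xi> k w) + b)\<^sup>2) = \<kappa>" .
  qed
  have "AE w in M. convergent (\<lambda>n. \<Sum>k<n. c k * (g (y k w) (\<xi> k w) - \<phi> (y k w)) $ i)" for i
  proof (rule martingale_difference_convergent[where G = G])
    have hm[measurable]: "(\<lambda>(u, s). c k * (g u s - \<phi> u) $ i) \<in> borel_measurable (?K \<Otimes>\<^sub>M S)" for k
    proof -
      have "(\<lambda>p. g (fst p) (snd p)) \<in> borel_measurable (?K \<Otimes>\<^sub>M S)"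
        using g by (simp add: case_prod_beta')
      then have "(\<lambda>p. c k * (g (fst p) (snd p) - \<phi> (fst p)) $ i) \<in> borel_measurable (?K \<Otimes>\<^sub>M S)"
        by measurable
      then show ?thesis by (simp add: case_prod_beta')
    qed
    show Xm: "(\<lambda>w. c k * (g (y k w) (\<xi> k w) - \<phi> (y k w)) $ i) \<in> borel_measurable (G (Suc k))" for k
      using measurable_compose[OF measurable_Pair[OF measurable_from_subalg[OF sub y] \<xi>] hm] by simp
    have X_le: "\<bar>c k * (g (y k w) (\<xi> k w) - \<phi> (y k w)) $ i\<bar> \<le> \<bar>c k * (l (\<xi> k w) + b)\<bar>"
      if "w \<in> space M" for k w
    proof -
      have "\<bar>(g (y k w) (\<xi> k w) - \<phi> (y k w)) $ i\<bar> \<le> norm (g (y k w) (\<xi> k w) - \<phi> (y k w))"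
        by (rule component_le_norm_cart)
      also have "\<dots> \<le> l (\<xi> k w) + b"
        using bound[OF yX \<xi>S(1), OF that that] \<phi>_bound[OF yX, OF that]
        by (intro order_trans[OF norm_triangle_ineq4]) (rule add_mono)
      finally show ?thesis by (simp add: abs_mult mult_left_mono)
    qed
    have X2_le: "(c k * (g (y k w) (\<xi> k w) - \<phi> (y k w)) $ i)\<^sup>2 \<le> (c k)\<^sup>2 * (l (\<xi> k w) + b)\<^sup>2"
      if "w \<in> space M" for k w
      using X_le[OF that, of k] by (simp add: abs_le_square_iff power_mult_distrib)
    have [measurable]: "(\<lambda>w. c k * (g (y k w) (\<xi> k w) - \<phi> (y k w)) $ i) \<in> borel_measurable M" for k
      by (rule measurable_from_subalg[OF G(1) Xm])
    show X2: "integrable M (\<lambda>w. (c k * (g (y k w) (\<xi> k w) - \<phi> (y k w)) $ i)\<^sup>2)" for k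
      using X2_le[of _ k] by (intro Bochner_Integration.integrable_bound[OF integrable_mult_right[OF int_lbk, of "(c k)\<^sup>2" k]])
        (auto simp: abs_mult)
    have X1: "integrable M (\<lambda>w. c k * (g (y k w) (\<xi> k w) - \<phi> (y k w)) $ i)" for k
      by (rule square_integrable_imp_integrable[OF _ X2]) measurable
    show "expectation (\<lambda>w. W w * (c k * (g (y k w) (\<xi> k w) - \<phi> (y k w)) $ i)) = 0"
      if W: "W \<in> borel_measurable (G k)" "\<And>w. \<bar>W w\<bar> \<le> r" for k W r
    proof (rule expectation_mult_fresh_eq_0[where h = "\<lambda>u s. c k * (g u s - \<phi> u) $ i",
          OF fresh \<xi>M G(1) y W(1) hm])
      show "(LINT s|distr M S (\<xi> k). c k * (g u s - \<phi> u) $ i) = 0" if u: "u \<in> space ?K" for u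
      proof -
        have uX: "u \<in> X" using u by (simp add: space_restrict_space)
        note [measurable] = g_sec[OF uX]
        note int = g_int[OF uX]
        have "(LINT s|distr M S (\<xi> k). c k * (g u s - \<phi> u) $ i) = (LINT w|M. c k * (g u (\<xi>\<^sub>0 w) - \<phi> u) $ i)"
          unfolding ident by (subst integral_distr) auto
        also have "\<dots> = c k * ((LINT w|M. g u (\<xi>\<^sub>0 w) - \<phi> u) $ i)"
          using int by (subst integral_mult_right_zero)
            (subst integral_bounded_linear[OF bounded_linear_vec_nth], auto)
        also have "\<dots> = 0" using int by (simp add: mean[OF uX] prob_space)
        finally show ?thesis .
      qed
      show "integrable M (\<lambda>w. W w * (c k * (g (y k w) (\<xi> k w) - \<phi> (y k w)) $ i))"
      proof (rule Bochner_Integration.integrable_bound)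
        show "integrable M (\<lambda>w. r * (c k * (g (y k w) (\<xi> k w) - \<phi> (y k w)) $ i))"
          using X1 by simp
        have "(\<lambda>w. W w) \<in> borel_measurable M" by (rule measurable_from_subalg[OF G(1) W(1)])
        then show "(\<lambda>w. W w * (c k * (g (y k w) (\<xi> k w) - \<phi> (y k w)) $ i)) \<in> borel_measurable M"
          by measurable
        have "\<bar>W w\<bar> \<le> \<bar>r\<bar>" for w using W(2)[of w] by simp
        then show "AE w in M. norm (W w * (c k * (g (y k w) (\<xi> k w) - \<phi> (y k w)) $ i))
            \<le> norm (r * (c k * (g (y k w) (\<xi> k w) - \<phi> (y k w)) $ i))"
          by (simp only: real_norm_def abs_mult) (auto intro!: mult_right_mono)
      qed
    qed
    show "summable (\<lambda>k. expectation (\<lambda>w. (c k * (g (y k w) (\<xi> k w) - \<phi> (y k w)) $ i)\<^sup>2))"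
    proof (rule summable_comparison_test'[OF summable_mult2[OF c, of \<kappa>], of 0])
      fix k
      have "expectation (\<lambda>w. (c k * (g (y k w) (\<xi> k w) - \<phi> (y k w)) $ i)\<^sup>2)
          \<le> expectation (\<lambda>w. (c k)\<^sup>2 * (l (\<xi> k w) + b)\<^sup>2)"
        using X2_le by (intro integral_mono X2 integrable_mult_right int_lbk)
      then show "norm (expectation (\<lambda>w. (c k * (g (y k w) (\<xi> k w) - \<phi> (y k w)) $ i)\<^sup>2)) \<le> (c k)\<^sup>2 * \<kappa>"
        by (simp add: \<kappa>)
    qed
  qed (use G in auto)
  then have "AE w in M. \<forall>i\<in>UNIV. convergent (\<lambda>n. \<Sum>k<n. c k * (g (y k w) (\<xi> k w) - \<phi> (y k w)) $ i)"
    by (intro AE_finite_allI) auto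
  then show ?thesis
  proof eventually_elim
    case (elim w)
    then have "\<forall>i. \<exists>L. (\<lambda>n. \<Sum>k<n. c k * (g (y k w) (\<xi> k w) - \<phi> (y k w)) $ i) \<longlonglongrightarrow> L"
      by (simp add: convergent_def)
    from choice[OF this]
    obtain L where L: "\<forall>i. (\<lambda>n. \<Sum>k<n. c k * (g (y k w) (\<xi> k w) - \<phi> (y k w)) $ i) \<longlonglongrightarrow> L i"
      by blast
    have "(\<lambda>n. \<Sum>k<n. c k *\<^sub>R (g (y k w) (\<xi> k w) - \<phi> (y k w))) \<longlonglongrightarrow> (\<chi> i. L i)"
      using L by (intro vec_tendstoI) (simp add: sum_component)
    then show ?case by (auto simp: summable_def sums_def)
  qed
qed

section \<open>Square-summability of the step-sizes and of their rescalings\<close>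

lemma summable_step_squared:
  assumes "0 < a" "1 / 2 < \<alpha>"
  shows "summable (\<lambda>k. (a / real (Suc k) powr \<alpha>)\<^sup>2)"
proof -
  have "summable (\<lambda>k. a\<^sup>2 * real (Suc k) powr (- 2 * \<alpha>))"
    using assms
    by (intro summable_mult summable_Suc_iff[of "\<lambda>n. real n powr (- 2 * \<alpha>)", THEN iffD2])
       (simp add: summable_real_powr_iff)
  moreover have "a\<^sup>2 * real (Suc k) powr (- 2 * \<alpha>) = (a / real (Suc k) powr \<alpha>)\<^sup>2" for k
    by (simp add: power_divide powr_minus_divide power2_eq_square powr_add[symmetric] del: of_nat_Suc)
  ultimately show ?thesis by (simp only:)
qed

text \<open>The noise of one step is divided by the scale of the next, hence the mixed quotient. It
  is s_k^(1 - \<delta>) times a ratio of at most 2, and the squares are compared with a series of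
  exponent \<open>2 * \<alpha> * (1 - \<delta>)\<close>, which exceeds 1 exactly under the upper
  bound on \<open>\<delta>\<close>.\<close>

lemma summable_step_ratio_squared:
  fixes a \<alpha> \<delta> :: real
  defines "s \<equiv> \<lambda>k. a / real (Suc k) powr \<alpha>"
  assumes "0 < a" "0 < \<alpha>" "\<alpha> < 1" "0 < \<delta>" "\<delta> < 1 - 1 / (2 * \<alpha>)"
  shows "summable (\<lambda>k. (s k / s (Suc k) powr \<delta>)\<^sup>2)"
proof -
  have \<delta>: "\<delta> < 1" using assms by (smt (verit) divide_pos_pos)
  have exp: "2 * \<alpha> * (1 - \<delta>) > 1" using assms by (simp add: field_simps)
  have "summable (\<lambda>k. 4 * a powr (2 * (1 - \<delta>)) * real (Suc k) powr (- (2 * \<alpha> * (1 - \<delta>))))"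
    using exp
    by (intro summable_mult summable_Suc_iff[of "\<lambda>n. real n powr (- (2 * \<alpha> * (1 - \<delta>)))", THEN iffD2])
       (simp add: summable_real_powr_iff)
  then show ?thesis
  proof (rule summable_comparison_test'[of _ 0])
    fix k
    have s0: "0 < s k" "0 < s (Suc k)" using assms by (auto simp: s_def)
    have "s k / s (Suc k) powr \<delta> = s k powr (1 - \<delta>) * (s k powr \<delta> / s (Suc k) powr \<delta>)"
      using s0 by (simp add: powr_diff)
    also have "\<dots> \<le> s k powr (1 - \<delta>) * 2"
    proof (rule mult_left_mono)
      have "s k powr \<delta> / s (Suc k) powr \<delta> \<le> 1 + 1 / real (Suc k)"
        unfolding s_def using assms \<delta> by (intro step_powr_ratio_le) auto
      also have "\<dots> \<le> 2" by simp
      finally show "s k powr \<delta> / s (Suc k) powr \<delta> \<le> 2" .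
    qed simp
    finally have "(s k / s (Suc k) powr \<delta>)\<^sup>2 \<le> (s k powr (1 - \<delta>) * 2)\<^sup>2"
      using s0 by (intro power_mono) auto
    also have "\<dots> = 4 * s k powr (2 * (1 - \<delta>))" 
      by (simp add: power_mult_distrib power2_eq_square powr_add[symmetric])
    also have "s k powr (2 * (1 - \<delta>)) = a powr (2 * (1 - \<delta>)) * real (Suc k) powr (- (2 * \<alpha> * (1 - \<delta>)))"
      using assms by (simp add: s_def powr_divide powr_powr powr_minus_divide mult_ac del: of_nat_Suc)
    finally show "norm ((s k / s (Suc k) powr \<delta>)\<^sup>2)
        \<le> 4 * a powr (2 * (1 - \<delta>)) * real (Suc k) powr (- (2 * \<alpha> * (1 - \<delta>)))" by simp
  qed
qed

section \<open>Almost sure rate for the distributed iteration\<close>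

theorem theorem2:
  fixes M :: "'w measure"
    and S :: "'m::finite \<Rightarrow> 's measure"
    and \<xi>\<^sub>0 :: "'m \<Rightarrow> 'w \<Rightarrow> 's"
    and \<xi> :: "'m \<Rightarrow> nat \<Rightarrow> 'w \<Rightarrow> 's"
    and B :: "real ^ 'd ^ 'p" and b :: "real ^ 'p"
    and C :: "real ^ 'd ^ 'q" and c :: "real ^ 'q"
    and X :: "(real ^ 'd) set"
    and F :: "'m \<Rightarrow> real ^ 'd \<Rightarrow> 's \<Rightarrow> real"
    and gradF :: "'m \<Rightarrow> real ^ 'd \<Rightarrow> 's \<Rightarrow> real ^ 'd"
    and L\<^sub>0 :: "'m \<Rightarrow> 's \<Rightarrow> real"
    and fj :: "'m \<Rightarrow> real ^ 'd \<Rightarrow> real"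
    and gradfj :: "'m \<Rightarrow> real ^ 'd \<Rightarrow> real ^ 'd"
    and f :: "real ^ 'd \<Rightarrow> real"
    and gradf :: "real ^ 'd \<Rightarrow> real ^ 'd"
    and H :: "real ^ 'd ^ 'd"
    and xs :: "real ^ 'd"
    and A :: "nat \<Rightarrow> 'w \<Rightarrow> real ^ 'm ^ 'm"
    and z\<^sub>0 :: "'m \<Rightarrow> 'w \<Rightarrow> real ^ 'd"
    and x z :: "'m \<Rightarrow> nat \<Rightarrow> 'w \<Rightarrow> real ^ 'd"
    and xbar zbar :: "nat \<Rightarrow> 'w \<Rightarrow> real ^ 'd"
    and step :: "nat \<Rightarrow> real"
    and L c\<^sub>0 \<epsilon> \<mu> \<rho> a \<alpha> \<delta> :: real
  assumes prob: "prob_space M"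
    and X_def: "X = feasible_set B b C c"
    and \<xi>\<^sub>0_rv: "\<And>j. \<xi>\<^sub>0 j \<in> measurable M (S j)"
    and F_integrable: "\<And>j y. y \<in> X \<Longrightarrow> integrable M (\<lambda>\<omega>. F j y (\<xi>\<^sub>0 j \<omega>))"
    and fj_def: "\<And>j y. y \<in> X \<Longrightarrow> fj j y = (LINT \<omega>|M. F j y (\<xi>\<^sub>0 j \<omega>))"
    and f_def: "\<And>y. f y = (\<Sum>j\<in>UNIV. fj j y)"
    and gradF: "\<And>j s. s \<in> space (S j) \<Longrightarrow> has_gradient_on (\<lambda>y. F j y s) (\<lambda>y. gradF j y s) X"
    and gradF_measurable: "\<And>j. (\<lambda>(y, s). gradF j y s) \<in> borel_measurable (restrict_space borel X \<Otimes>\<^sub>M S j)"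
    and gradfj: "\<And>j. has_gradient_on (fj j) (gradfj j) X"
    and gradfj_expectation: "\<And>j y. y \<in> X \<Longrightarrow> gradfj j y = (LINT \<omega>|M. gradF j y (\<xi>\<^sub>0 j \<omega>))"
    and gradf_def: "\<And>y. gradf y = (\<Sum>j\<in>UNIV. gradfj j y)"
    and hessian: "(gradf has_derivative (\<lambda>h. H *v h)) (at xs within X)"
    and z\<^sub>0_rv: "\<And>j. z\<^sub>0 j \<in> borel_measurable M"
    and z_init: "\<And>j \<omega>. z j 0 \<omega> = z\<^sub>0 j \<omega>"
    and x_step: "\<And>j k \<omega>. k \<ge> 1 \<Longrightarrow> x j k \<omega> = dual_map X (z j (k - 1) \<omega>)"
    and z_step: "\<And>j k \<omega>. k \<ge> 1 \<Longrightarrow>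
           z j k \<omega> = (\<Sum>i\<in>UNIV. (A k \<omega> $ j $ i) *\<^sub>R z i (k - 1) \<omega>) - step k *\<^sub>R gradF j (x j k \<omega>) (\<xi> j k \<omega>)"
    and zbar_def: "\<And>k \<omega>. zbar k \<omega> = (1 / real CARD('m)) *\<^sub>R (\<Sum>j\<in>UNIV. z j k \<omega>)"
    and xbar_def: "\<And>k \<omega>. xbar (k + 1) \<omega> = dual_map X (zbar k \<omega>)"
    and xs_minimizer: "is_arg_min f (\<lambda>y. y \<in> X) xs"
    and xs_limit: "AE \<omega> in M. (\<lambda>k. xbar k \<omega>) \<longlonglongrightarrow> xs"
    and xs_active: "B *v xs = b"
    and xs_inactive: "\<And>i. (C *v xs) $ i < c $ i"
    and F_convex: "\<And>j s. s \<in> space (S j) \<Longrightarrow> convex_on X (\<lambda>y. F j y s)"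
    and F_lipschitz: "\<And>j s y y'. s \<in> space (S j) \<Longrightarrow> y \<in> X \<Longrightarrow> y' \<in> X \<Longrightarrow>
           \<bar>F j y s - F j y' s\<bar> \<le> L\<^sub>0 j s * norm (y - y')"
    and gradF_bound: "\<And>j s y. s \<in> space (S j) \<Longrightarrow> y \<in> X \<Longrightarrow> norm (gradF j y s) \<le> L\<^sub>0 j s"
    and L\<^sub>0_measurable: "\<And>j. L\<^sub>0 j \<in> borel_measurable (S j)"
    and L\<^sub>0_square_integrable: "\<And>j. integrable M (\<lambda>\<omega>. (L\<^sub>0 j (\<xi>\<^sub>0 j \<omega>))\<^sup>2)"
    and L_pos: "L > 0"
    and gradfj_lipschitz: "\<And>j y y'. y \<in> X \<Longrightarrow> y' \<in> X \<Longrightarrow>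
           norm (gradfj j y - gradfj j y') \<le> L * norm (y - y')"
    and c\<^sub>0_pos: "c\<^sub>0 > 0" and \<epsilon>_pos: "\<epsilon> > 0"
    and second_order_expansion: "\<And>y. y \<in> X \<Longrightarrow> norm (y - xs) \<le> \<epsilon> \<Longrightarrow>
           norm (gradf y - gradf xs - H *v (y - xs)) \<le> c\<^sub>0 * (norm (y - xs))\<^sup>2"
    and \<mu>_pos: "\<mu> > 0"
    and restricted_strong_convexity: "\<And>y. y \<in> critical_tangent_cone B \<Longrightarrow> y \<bullet> (H *v y) \<ge> \<mu> * (norm y)\<^sup>2"
    and constraint_qualification: "- gradf xs \<in> rel_interior (active_normal_cone B)"
    and A_indep: "prob_space.indep_vars M (\<lambda>_. borel) A {1..}"
    and A_ident: "\<And>k. k \<ge> 1 \<Longrightarrow> identically_distributed M borel (A k) (A 1)"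
    and A_doubly_stochastic: "\<And>k. k \<ge> 1 \<Longrightarrow> AE \<omega> in M. doubly_stochastic (A k \<omega>)"
    and \<rho>_def: "\<And>k. k \<ge> 1 \<Longrightarrow>
           \<rho> = spectral_norm (LINT \<omega>|M. transpose (A k \<omega>) ** (mat 1 - averaging_matrix) ** A k \<omega>)"
    and \<rho>_less: "\<rho> < 1"
    and A_fresh: "\<And>k. k \<ge> 1 \<Longrightarrow> indep_of_algebra M borel (A k) (history M S z\<^sub>0 \<xi> A k)"
    and step_def: "\<And>k. k \<ge> 1 \<Longrightarrow> step k = a / real k powr \<alpha>"
    and \<alpha>_range: "2 / 3 < \<alpha>" "\<alpha> < 1" and a_pos: "a > 0"
    and \<xi>_indep: "\<And>j. prob_space.indep_vars M (\<lambda>_. S j) (\<xi> j) {1..}"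
    and \<xi>_ident: "\<And>j k. k \<ge> 1 \<Longrightarrow> identically_distributed M (S j) (\<xi> j k) (\<xi>\<^sub>0 j)"
    and \<xi>_fresh: "\<And>j k. k \<ge> 1 \<Longrightarrow> indep_of_algebra M (S j) (\<xi> j k) (history M S z\<^sub>0 \<xi> A k)"
    and \<xi>_cond_indep: "\<And>i j k. k \<ge> 1 \<Longrightarrow> i \<noteq> j \<Longrightarrow>
           cond_indep M (adjoin M (history M S z\<^sub>0 \<xi> A k) borel (A k)) (S i) (\<xi> i k) (S j) (\<xi> j k)"
    and \<xi>_A_cond_indep: "\<And>j k. k \<ge> 1 \<Longrightarrow>
           cond_indep M (history M S z\<^sub>0 \<xi> A k) (S j) (\<xi> j k) borel (A k)"
    and \<delta>_range: "0 < \<delta>" "\<delta> < 1 - 1 / (2 * \<alpha>)"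
  shows "AE \<omega> in M. (\<lambda>k. norm (proj_ker B *v (xbar k \<omega> - xs))) \<in> o(\<lambda>k. step k powr \<delta>)"
proof -
  interpret prob_space M by (rule prob)
  define m where "m = real CARD('m)"
  \<comment> \<open>Shift by one: \<open>s k\<close> is the step-size of step k + 1, and
    \<open>G k\<close> is the history from which the sample and the weights of that step are
    independent.\<close>
  define s where "s k = a / real (Suc k) powr \<alpha>" for k
  define G where "G k = history M S z\<^sub>0 \<xi> A (Suc k)" for k
  let ?E = "centering_matrix :: real ^ 'm ^ 'm"
  have m: "0 < m" by (simp add: m_def)
  have step_s: "step (Suc k) = s k" for k using step_def[of "Suc k"] by (simp add: s_def)
  have s0: "0 < s k" for k using a_pos by (simp add: s_def)
  have \<alpha>0: "0 < \<alpha>" "1 / 2 < \<alpha>" using \<alpha>_range by auto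
  have \<delta>1: "\<delta> < 1" using \<delta>_range \<alpha>0 by (smt (verit) divide_pos_pos)

  have ss1: "summable (\<lambda>k. (s k)\<^sup>2)"
    unfolding s_def using a_pos \<alpha>0(2) by (rule summable_step_squared)
  have ss2: "summable (\<lambda>k. (s k / s (Suc k) powr \<delta>)\<^sup>2)"
    unfolding s_def using a_pos \<alpha>0(1) \<alpha>_range(2) \<delta>_range by (rule summable_step_ratio_squared)

  have "xs \<in> X" using xs_active xs_inactive by (simp add: X_def feasible_set_iff less_imp_le)
  then have X: "closed X" "convex X" "X \<noteq> {}"
    using closed_feasible_set convex_feasible_set by (auto simp: X_def)
  note dual = dual_map_eq_closest_point[OF X]
  have cpX: "closest_point X y \<in> X" for y using X by (intro closest_point_in_set)
  have cp_meas: "closest_point X \<in> measurable borel (restrict_space borel X)"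
    using cpX X
    by (intro measurable_restrict_space2 borel_measurable_continuous_onI continuous_on_closest_point) auto
  have x_S: "x j (Suc k) w = closest_point X (z j k w)" for j k w
    using x_step[of "Suc k" j w] by (simp add: dual)
  have xbar_S: "xbar (Suc k) w = closest_point X (zbar k w)" for k w
    using xbar_def[of k w] by (simp add: dual)
  have z_S: "z j (Suc k) w = (\<Sum>i\<in>UNIV. (A (Suc k) w $ j $ i) *\<^sub>R z i k w)
      - s k *\<^sub>R gradF j (x j (Suc k) w) (\<xi> j (Suc k) w)" for j k w
    using z_step[of "Suc k" j w] by (simp add: step_s)

  have \<xi>M: "\<xi> j t \<in> measurable M (S j)" if "1 \<le> t" for j t
    using \<xi>_indep[of j] that unfolding indep_vars_def by auto
  have AM: "A t \<in> borel_measurable M" if "1 \<le> t" for t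
    using A_indep that unfolding indep_vars_def by auto
  have G: "subalgebra M (G k)" for k
    unfolding G_def using z\<^sub>0_rv \<xi>M AM by (rule subalgebra_history)
  have G_mono: "sets (G k) \<subseteq> sets (G (Suc k))" for k
    unfolding G_def by (intro history_mono) simp
  have G_sub: "subalgebra (G (Suc k)) (G k)" for k
    using G[of k] G[of "Suc k"] G_mono by (simp add: subalgebra_def)
  have \<xi>G: "\<xi> j (Suc k) \<in> measurable (G (Suc k)) (S j)" for j k
    unfolding G_def by (rule measurable_history_sample[where S = S]) (auto intro: \<xi>M)
  have AG: "A (Suc k) \<in> borel_measurable (G (Suc k))" for k
    unfolding G_def by (rule measurable_history_weights) auto
  have \<xi>_freshG: "indep_of_algebra M (S j) (\<xi> j (Suc k)) (G k)" for j k
    unfolding G_def using \<xi>_fresh[of "Suc k" j] by simp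
  have A_freshG: "indep_of_algebra M borel (A (Suc k)) (G k)" for k
    unfolding G_def using A_fresh[of "Suc k"] by simp
  have \<xi>_distr: "distr M (S j) (\<xi> j (Suc k)) = distr M (S j) (\<xi>\<^sub>0 j)" for j k
    using \<xi>_ident[of "Suc k" j] by (simp add: identically_distributed_def)
  have gradF_comp: "(\<lambda>w. gradF j (y w) (r w)) \<in> borel_measurable N"
    if "y \<in> measurable N (restrict_space borel X)" "r \<in> measurable N (S j)" for j y r and N :: "'w measure"
    using measurable_compose[OF measurable_Pair[OF that] gradF_measurable] by simp

  \<comment> \<open>The new dual variables use the sample and the weights of step k + 1, known in
    \<open>G (Suc k)\<close>. The point at which the gradient is taken depends on \<open>G k\<close>
    only, which is what makes the noise a martingale difference.\<close>
  have zG: "z j k \<in> borel_measurable (G k)" for j k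
  proof (induction k arbitrary: j)
    case 0
    have "z j 0 = z\<^sub>0 j" using z_init by auto
    then show ?case by (simp add: G_def measurable_history_initial)
  next
    case (Suc k)
    have zz: "z i k \<in> borel_measurable (G (Suc k))" for i
      by (rule measurable_from_subalg[OF G_sub Suc])
    have "x j (Suc k) = (\<lambda>w. closest_point X (z j k w))" using x_S by auto
    then have "x j (Suc k) \<in> measurable (G (Suc k)) (restrict_space borel X)"
      using measurable_compose[OF zz cp_meas] by simp
    then have "(\<lambda>w. gradF j (x j (Suc k) w) (\<xi> j (Suc k) w)) \<in> borel_measurable (G (Suc k))"
      by (rule gradF_comp[OF _ \<xi>G])
    moreover have "(\<lambda>w. (A (Suc k) w $ j $ i) *\<^sub>R z i k w) \<in> borel_measurable (G (Suc k))" for i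
    proof -
      note [measurable] = AG zz
      show ?thesis by measurable
    qed
    ultimately have "(\<lambda>w. (\<Sum>i\<in>UNIV. (A (Suc k) w $ j $ i) *\<^sub>R z i k w)
        - s k *\<^sub>R gradF j (x j (Suc k) w) (\<xi> j (Suc k) w)) \<in> borel_measurable (G (Suc k))"
      by measurable
    then show ?case using z_S by (subst measurable_cong) auto
  qed
  have xG: "x j (Suc k) \<in> measurable (G k) (restrict_space borel X)" for j k
  proof -
    have "x j (Suc k) = (\<lambda>w. closest_point X (z j k w))" using x_S by auto
    then show ?thesis using measurable_compose[OF zG cp_meas] by simp
  qed
  have gradM: "(\<lambda>w. gradF j (x j (Suc k) w) (\<xi> j (Suc k) w)) \<in> borel_measurable M" for j k
    by (rule gradF_comp[OF measurable_from_subalg[OF G xG] \<xi>M]) simp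

  have noise: "AE w in M. summable (\<lambda>k. c k *\<^sub>R
      (gradF j (x j (Suc k) w) (\<xi> j (Suc k) w) - gradfj j (x j (Suc k) w)))"
    if "summable (\<lambda>k. (c k)\<^sup>2)" for j c
    by (rule fresh_sample_noise_summable[where G = G and y = "\<lambda>k. x j (Suc k)" and \<xi> = "\<lambda>k. \<xi> j (Suc k)",
          OF G G_mono \<xi>\<^sub>0_rv[of j] gradF_measurable gradfj_expectation gradF_bound L\<^sub>0_measurable
            L\<^sub>0_square_integrable xG \<xi>G \<xi>_freshG \<xi>_distr that])

  \<comment> \<open>The weights act on the agent index, so one spatial coordinate \<open>i\<close>
    is fixed and its values over the agents form a vector in R^m; there the mixing is an ordinary
    matrix product.\<close>
  define u where "u i k w = ?E *v (\<chi> j. z j k w $ i)" for i k w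
  have u_nth: "u i k w $ j = z j k w $ i - zbar k w $ i" for i k w j
    by (simp add: u_def centering_matrix_mult zbar_def sum_component)
  define g where "g i k w = (\<chi> j. gradF j (x j (Suc k) w) (\<xi> j (Suc k) w) $ i)" for i k w
  define \<gamma> where "\<gamma> = (\<Sum>j\<in>UNIV. LINT w|M. (L\<^sub>0 j (\<xi>\<^sub>0 j w))\<^sup>2)"
  \<comment> \<open>The weights s_k^(-2 \<delta>) turn the conclusion into a disagreement of order
    o(s_k^\<delta>). They grow by at most (1 + 1/(k+1))^2 per step, and the summability they require
    is that of \<open>ss2\<close>.\<close>
  have consensus: "AE w in M. (\<lambda>k. s k powr (- 2 * \<delta>) * (norm (u i k w))\<^sup>2) \<longlonglongrightarrow> 0" for i
  proof (rule consensus_error[where G = G and A = "\<lambda>k. A (Suc k)" and g = "g i" and s = s and \<rho> = \<rho>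
        and \<gamma> = \<gamma> and \<theta> = "\<lambda>k. (1 + 1 / real (Suc k))\<^sup>2", OF G G_mono _ _ AM A_freshG])
    show "u i k \<in> borel_measurable (G k)" for k
    proof -
      have "(\<lambda>w. u i k w $ j) \<in> borel_measurable (G k)" for j
      proof -
        note [measurable] = zG
        show ?thesis unfolding u_nth zbar_def by measurable
      qed
      then have "(\<lambda>w. \<chi> j. u i k w $ j) \<in> borel_measurable (G k)" by (rule borel_measurable_vec_lambda)
      then show ?thesis by simp
    qed
    show "g i k \<in> borel_measurable M" for k
      unfolding g_def using gradM by (intro borel_measurable_vec_lambda borel_measurable_vec_component)
    show "AE w in M. doubly_stochastic (A (Suc k) w)" for k by (rule A_doubly_stochastic) simp
    show "spectral_norm (LINT w|M. transpose (A (Suc k) w) ** ?E ** A (Suc k) w) \<le> \<rho>" for k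
      using \<rho>_def[of "Suc k"] by simp
    show "AE w in M. u i (Suc k) w = ?E *v (A (Suc k) w *v u i k w) - s k *\<^sub>R (?E *v g i k w)" for k
      using A_doubly_stochastic[of "Suc k", simplified]
    proof eventually_elim
      case (elim w)
      have "(\<chi> j. z j (Suc k) w $ i) = A (Suc k) w *v (\<chi> j. z j k w $ i) - s k *\<^sub>R g i k w"
        by (simp add: vec_eq_iff z_S g_def matrix_vector_mult_def sum_component)
      then have "u i (Suc k) w = ?E *v (A (Suc k) w *v (\<chi> j. z j k w $ i)) - s k *\<^sub>R (?E *v g i k w)"
        by (simp only: u_def matrix_vector_mult_diff_distrib matrix_vector_mult_scaleR)
      then show ?case
        by (simp only: u_def centering_matrix_doubly_stochastic[OF elim])
    qed
    show "(\<integral>\<^sup>+ w. ennreal ((norm (g i k w))\<^sup>2) \<partial>M) \<le> ennreal \<gamma>" for k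
    proof -
      have [measurable]: "\<xi> j (Suc k) \<in> measurable M (S j)" "\<xi>\<^sub>0 j \<in> measurable M (S j)"
        "L\<^sub>0 j \<in> borel_measurable (S j)" for j
        using \<xi>M \<xi>\<^sub>0_rv L\<^sub>0_measurable by auto
      have "(\<integral>\<^sup>+ w. ennreal ((norm (g i k w))\<^sup>2) \<partial>M)
          \<le> (\<integral>\<^sup>+ w. (\<Sum>j\<in>UNIV. ennreal ((L\<^sub>0 j (\<xi> j (Suc k) w))\<^sup>2)) \<partial>M)"
      proof (rule nn_integral_mono)
        fix w assume w: "w \<in> space M"
        have "(norm (g i k w))\<^sup>2 = (\<Sum>j\<in>UNIV. (gradF j (x j (Suc k) w) (\<xi> j (Suc k) w) $ i)\<^sup>2)"
          by (simp add: norm_vec_def L2_set_def sum_nonneg g_def)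
        also have "\<dots> \<le> (\<Sum>j\<in>UNIV. (L\<^sub>0 j (\<xi> j (Suc k) w))\<^sup>2)"
        proof (rule sum_mono)
          fix j
          have "\<bar>gradF j (x j (Suc k) w) (\<xi> j (Suc k) w) $ i\<bar> \<le> norm (gradF j (x j (Suc k) w) (\<xi> j (Suc k) w))"
            by (rule component_le_norm_cart)
          also have "\<dots> \<le> L\<^sub>0 j (\<xi> j (Suc k) w)"
            using measurable_space[OF \<xi>M[of "Suc k" j] w] cpX by (intro gradF_bound) (auto simp: x_S)
          finally show "(gradF j (x j (Suc k) w) (\<xi> j (Suc k) w) $ i)\<^sup>2 \<le> (L\<^sub>0 j (\<xi> j (Suc k) w))\<^sup>2"
            by (intro abs_le_square_iff[THEN iffD1]) simp
        qed
        finally show "ennreal ((norm (g i k w))\<^sup>2) \<le> (\<Sum>j\<in>UNIV. ennreal ((L\<^sub>0 j (\<xi> j (Suc k) w))\<^sup>2))"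
          by (simp add: sum_ennreal ennreal_leI)
      qed
      also have "\<dots> = (\<Sum>j\<in>UNIV. \<integral>\<^sup>+ w. ennreal ((L\<^sub>0 j (\<xi> j (Suc k) w))\<^sup>2) \<partial>M)"
        by (rule nn_integral_sum) measurable
      also have "\<dots> = (\<Sum>j\<in>UNIV. ennreal (LINT w|M. (L\<^sub>0 j (\<xi>\<^sub>0 j w))\<^sup>2))"
      proof (rule sum.cong[OF refl])
        fix j
        have "(\<integral>\<^sup>+ w. ennreal ((L\<^sub>0 j (\<xi> j (Suc k) w))\<^sup>2) \<partial>M)
            = (\<integral>\<^sup>+ r. ennreal ((L\<^sub>0 j r)\<^sup>2) \<partial>distr M (S j) (\<xi> j (Suc k)))"
          by (subst nn_integral_distr) auto
        also have "\<dots> = (\<integral>\<^sup>+ w. ennreal ((L\<^sub>0 j (\<xi>\<^sub>0 j w))\<^sup>2) \<partial>M)"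
          unfolding \<xi>_distr by (subst nn_integral_distr) auto
        also have "\<dots> = ennreal (LINT w|M. (L\<^sub>0 j (\<xi>\<^sub>0 j w))\<^sup>2)"
          by (rule nn_integral_eq_integral[OF L\<^sub>0_square_integrable]) simp
        finally show "(\<integral>\<^sup>+ w. ennreal ((L\<^sub>0 j (\<xi> j (Suc k) w))\<^sup>2) \<partial>M) = ennreal (LINT w|M. (L\<^sub>0 j (\<xi>\<^sub>0 j w))\<^sup>2)" .
      qed
      also have "\<dots> = ennreal \<gamma>" unfolding \<gamma>_def by (rule sum_ennreal) simp
      finally show ?thesis .
    qed
    have sq: "r powr (- 2 * \<delta>) = 1 / (r powr \<delta>)\<^sup>2" if "0 < r" for r
      by (simp add: powr_minus_divide power2_eq_square powr_add[symmetric])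
    show "s (Suc k) powr (- 2 * \<delta>) \<le> (1 + 1 / real (Suc k))\<^sup>2 * s k powr (- 2 * \<delta>)" for k
    proof -
      have "s k powr \<delta> / s (Suc k) powr \<delta> \<le> 1 + 1 / real (Suc k)"
        unfolding s_def using a_pos \<alpha>0 \<alpha>_range \<delta>_range \<delta>1 by (intro step_powr_ratio_le) auto
      then have "(s k powr \<delta> / s (Suc k) powr \<delta>)\<^sup>2 \<le> (1 + 1 / real (Suc k))\<^sup>2"
        by (intro power_mono) auto
      then show ?thesis
        unfolding sq[OF s0] using s0[of k] by (simp add: power_divide field_simps)
    qed
    show "(\<lambda>k. (1 + 1 / real (Suc k))\<^sup>2) \<longlonglongrightarrow> 1" by real_asymp
    show "summable (\<lambda>k. s (Suc k) powr (- 2 * \<delta>) * (s k)\<^sup>2)"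
      unfolding sq[OF s0] using ss2 by (simp add: power_divide)
  qed (use \<rho>_less s0 in \<open>auto simp: less_imp_neq[OF s0, symmetric]\<close>)

  have "AE w in M. \<forall>k. doubly_stochastic (A (Suc k) w)"
    using A_doubly_stochastic by (simp add: AE_all_countable)
  moreover have "AE w in M. \<forall>i\<in>UNIV. (\<lambda>k. s k powr (- 2 * \<delta>) * (norm (u i k w))\<^sup>2) \<longlonglongrightarrow> 0"
    using consensus by (intro AE_finite_allI) auto
  moreover have "AE w in M. \<forall>j\<in>UNIV. summable (\<lambda>k. s k *\<^sub>R
      (gradF j (x j (Suc k) w) (\<xi> j (Suc k) w) - gradfj j (x j (Suc k) w)))"
    by (intro AE_finite_allI noise ss1) simp
  moreover have "AE w in M. \<forall>j\<in>UNIV. summable (\<lambda>k. (s k / s (Suc k) powr \<delta>) *\<^sub>R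
      (gradF j (x j (Suc k) w) (\<xi> j (Suc k) w) - gradfj j (x j (Suc k) w)))"
    by (intro AE_finite_allI noise ss2) simp
  ultimately show ?thesis
    using xs_limit
  proof eventually_elim
    case (elim w)
    \<comment> \<open>\<open>e\<close> is the price of evaluating the mean gradients at the agents'
      own points instead of at the projected average; \<open>n\<close> is the averaged sampling
      noise.\<close>
    define e where "e k = (1 / m) *\<^sub>R (\<Sum>j\<in>UNIV. gradfj j (x j (Suc k) w) - gradfj j (xbar (Suc k) w))" for k
    define n where "n k = (1 / m) *\<^sub>R (\<Sum>j\<in>UNIV. gradF j (x j (Suc k) w) (\<xi> j (Suc k) w) - gradfj j (x j (Suc k) w))" for k
    have n_summable: "summable (\<lambda>k. c k *\<^sub>R n k)"
      if "\<forall>j\<in>UNIV. summable (\<lambda>k. c k *\<^sub>R (gradF j (x j (Suc k) w) (\<xi> j (Suc k) w) - gradfj j (x j (Suc k) w)))" for c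
    proof -
      have "summable (\<lambda>k. (1 / m) *\<^sub>R (\<Sum>j\<in>UNIV. c k *\<^sub>R
          (gradF j (x j (Suc k) w) (\<xi> j (Suc k) w) - gradfj j (x j (Suc k) w))))"
        using that by (intro summable_scaleR_right summable_sum) auto
      then show ?thesis by (simp add: n_def scaleR_sum_right mult.commute)
    qed
    have "(\<lambda>k. norm (proj_ker B *v (xbar (Suc k) w - xs)) / s k powr \<delta>) \<longlonglongrightarrow> 0"
    proof (rule dual_averaging_pathwise_rate[where B = B and b = b and C = C and c = c and z = "\<lambda>k. zbar k w"
          and a = a and \<alpha> = \<alpha> and \<delta> = \<delta> and gradf = gradf and H = H and m = m and e = e and n = n and \<mu> = \<mu> and ?c0.0 = c\<^sub>0 and \<epsilon> = \<epsilon>, folded X_def s_def xbar_S])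
      show "zbar (Suc k) w = zbar k w - s k *\<^sub>R ((1 / m) *\<^sub>R gradf (xbar (Suc k) w) + e k + n k)" for k
      proof -
        have ds: "doubly_stochastic (A (Suc k) w)" using elim(1) by blast
        have "(\<Sum>j\<in>UNIV. \<Sum>i\<in>UNIV. (A (Suc k) w $ j $ i) *\<^sub>R z i k w)
            = (\<Sum>i\<in>UNIV. (\<Sum>j\<in>UNIV. A (Suc k) w $ j $ i) *\<^sub>R z i k w)"
          by (subst sum.swap) (simp add: scaleR_sum_left)
        also have "\<dots> = (\<Sum>i\<in>UNIV. z i k w)" using ds by (simp add: doubly_stochastic_def)
        finally have "zbar (Suc k) w = zbar k w - s k *\<^sub>R ((1 / m) *\<^sub>R (\<Sum>j\<in>UNIV. gradF j (x j (Suc k) w) (\<xi> j (Suc k) w)))"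
          by (simp add: zbar_def z_S sum_subtractf scaleR_diff_right scaleR_sum_right[symmetric] m_def mult.commute)
        also have "(1 / m) *\<^sub>R (\<Sum>j\<in>UNIV. gradF j (x j (Suc k) w) (\<xi> j (Suc k) w))
            = (1 / m) *\<^sub>R gradf (xbar (Suc k) w) + e k + n k"
          by (simp add: e_def n_def gradf_def sum_subtractf scaleR_diff_right)
        finally show ?thesis .
      qed
      show "(\<lambda>k. xbar (Suc k) w) \<longlonglongrightarrow> xs" using elim(5) by (rule LIMSEQ_Suc)
      show "summable (\<lambda>k. s k *\<^sub>R n k)" "summable (\<lambda>k. (s k / s (Suc k) powr \<delta>) *\<^sub>R n k)"
        using elim(3,4) by (auto intro: n_summable)
      \<comment> \<open>Lipschitz gradients and the nonexpansive projection reduce this error to the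
        distance of the dual variables from their average, which is estimated coordinate by
        coordinate.\<close>
      have e_le: "norm (e k) \<le> L * (\<Sum>i\<in>UNIV. norm (u i k w))" for k
      proof -
        have "norm (gradfj j (x j (Suc k) w) - gradfj j (xbar (Suc k) w)) \<le> L * (\<Sum>i\<in>UNIV. norm (u i k w))" for j
        proof -
          have "norm (gradfj j (x j (Suc k) w) - gradfj j (xbar (Suc k) w)) \<le> L * norm (x j (Suc k) w - xbar (Suc k) w)"
            by (rule gradfj_lipschitz) (simp_all add: x_S xbar_S cpX)
          also have "norm (x j (Suc k) w - xbar (Suc k) w) \<le> norm (z j k w - zbar k w)"
            using closest_point_lipschitz[OF X(2,1,3)] by (simp add: x_S xbar_S dist_norm)
          also have "\<dots> \<le> (\<Sum>i\<in>UNIV. \<bar>(z j k w - zbar k w) $ i\<bar>)" by (rule norm_le_l1_cart)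
          also have "\<dots> \<le> (\<Sum>i\<in>UNIV. norm (u i k w))"
            using component_le_norm_cart by (intro sum_mono) (simp add: u_nth[symmetric])
          finally show ?thesis using L_pos by simp
        qed
        then have "norm (\<Sum>j\<in>UNIV. gradfj j (x j (Suc k) w) - gradfj j (xbar (Suc k) w))
            \<le> (\<Sum>j\<in>(UNIV::'m set). L * (\<Sum>i\<in>UNIV. norm (u i k w)))"
          by (rule sum_norm_le)
        then show ?thesis using m by (simp add: e_def m_def field_simps)
      qed
      have u_lim: "(\<lambda>k. norm (u i k w) / s k powr \<delta>) \<longlonglongrightarrow> 0" for i
      proof -
        have "(\<lambda>k. sqrt (s k powr (- 2 * \<delta>) * (norm (u i k w))\<^sup>2)) \<longlonglongrightarrow> sqrt 0"
          using elim(2) by (intro tendsto_real_sqrt) auto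
        moreover have "sqrt (s k powr (- 2 * \<delta>) * (norm (u i k w))\<^sup>2) = norm (u i k w) / s k powr \<delta>" for k
        proof (rule real_sqrt_unique)
          have "s k powr (- 2 * \<delta>) = 1 / (s k powr \<delta>)\<^sup>2"
            by (simp add: powr_minus_divide power2_eq_square powr_add[symmetric])
          then show "(norm (u i k w) / s k powr \<delta>)\<^sup>2 = s k powr (- 2 * \<delta>) * (norm (u i k w))\<^sup>2"
            by (simp add: power_divide)
        qed simp
        ultimately show ?thesis by simp
      qed
      show "(\<lambda>k. norm (e k) / s k powr \<delta>) \<longlonglongrightarrow> 0"
      proof (rule Lim_null_comparison)
        show "\<forall>\<^sub>F k in sequentially. norm (norm (e k) / s k powr \<delta>) \<le> L * (\<Sum>i\<in>UNIV. norm (u i k w) / s k powr \<delta>)"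
          using e_le by (intro always_eventually allI)
            (simp add: sum_divide_distrib[symmetric] divide_right_mono)
        have "(\<lambda>k. L * (\<Sum>i\<in>UNIV. norm (u i k w) / s k powr \<delta>)) \<longlonglongrightarrow> L * (\<Sum>i\<in>(UNIV::'d set). 0)"
          by (intro tendsto_intros u_lim)
        then show "(\<lambda>k. L * (\<Sum>i\<in>UNIV. norm (u i k w) / s k powr \<delta>)) \<longlonglongrightarrow> 0" by simp
      qed
    qed (use assms m \<alpha>0 \<delta>1 in auto)
    then have "(\<lambda>k. norm (proj_ker B *v (xbar (Suc k) w - xs)) / step (Suc k) powr \<delta>) \<longlonglongrightarrow> 0"
      by (simp only: step_s)
    then have "(\<lambda>k. norm (proj_ker B *v (xbar k w - xs)) / step k powr \<delta>) \<longlonglongrightarrow> 0"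
      by (rule LIMSEQ_imp_Suc)
    \<comment> \<open>\<open>step\<close> is specified from index 1 on, so the denominator is known
      to be nonzero only eventually.\<close>
    moreover have "\<forall>\<^sub>F k in sequentially. step k powr \<delta> \<noteq> 0"
      using eventually_gt_at_top[of 0] by eventually_elim (use step_def a_pos in auto)
    ultimately show ?case by (intro smalloI_tendsto)
  qed
qed

end
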